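(* Consider a layered computational graph with terminal vector feedback, backpropagated gradients $\mathbf g_v$, and synthetic gradient propagation $\tilde{\mathbf g}_v$ with node-wise mixing weights $\lambda_v\in[0,1]$, as described in the context. Let $\epsilon,\epsilon',J>0$ be constants such that: (B') for every non-input node $u$ and every subset $U\subseteq \mathrm{an}_{\mathrm{sib}}(u)$, $\bigl\|\mathbb E[\mathbf g_u\mid \mathbf z_u]-\mathbb E[\mathbf g_u\mid \mathbf z_u,\mathbf Z_U]\bigr\|_2\le\epsilon$ almost surely; for each edge $u\to u^+$ the synthetic gradient has the form $\tilde{\mathbf h}_u^{u^+}=\mathbf J_u^{u^+}\tilde{\mathbf h}_{u^+}$ with $\bigl\|\tilde{\mathbf h}_{u^+}-\mathbb E[\tilde{\mathbf g}_{u^+}\mid\mathbf z_{u^+}]\bigr\|_2\le\epsilon'$ almost surely; $\max\{\|\mathbf J_u^{u^+}\|_2,\|\mathbf J_u^\theta\|_2\}\le J$ for all nodes $u$ and children $u^+$. Fix a non-terminal (non-input) node $v$, set $$\tilde{\mathbf p}_v:=\mathbf J_v^\theta\sum_{v^+\in \mathrm{ch}(v)}\mathbf J_v^{v^+}\tilde{\mathbf g}_{v^+},\qquad \tilde{\mathbf s}_v:=\mathbf J_v^\theta\sum_{v^+\in \mathrm{ch}(v)}\tilde{\mathbf h}_v^{v^+},$$ so that $\tilde{\mathbf g}_v^\theta=\lambda_v\tilde{\mathbf p}_v+(1-\lambda_v)\tilde{\mathbf s}_v$. Let $\hat{\tilde{\mathbf p}}_v,\hat{\tilde{\mathbf s}}_v$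 be the empirical means of $\tilde{\mathbf p}_v,\tilde{\mathbf s}_v$ over $n$ i.i.d. samples, and let $$\lambda_v^\star:=\arg\min_{\lambda_v\in[0,1]}\ \mathbb E\bigl\|\lambda_v\hat{\tilde{\mathbf p}}_v+(1-\lambda_v)\hat{\tilde{\mathbf s}}_v-\mathbb E\,\mathbf g_v^\theta\bigr\|_2^2,$$ with the convention $\lambda_v^\star:=0$ if $\tilde{\mathbf p}_v=\tilde{\mathbf s}_v$ almost surely (otherwise the minimizer is unique). Define constants $c_u$, $u\in V$, recursively by $c_u=0$ for $u\in V_L$ and $c_u=J\sum_{u^+\in \mathrm{ch}(u)}(1-\lambda_u+c_{u^+})$ for non-terminal $u$. If $$\frac{\operatorname{tr}\operatorname{Cov}(\tilde{\mathbf p}_v)-\operatorname{tr}\operatorname{Cov}(\tilde{\mathbf s}_v)}{n}>\Bigl(J^2(\epsilon+\epsilon')\sum_{v^+\in \mathrm{ch}(v)}(1+c_{v^+})\Bigr)^2,$$ then $\lambda_v^\star<1$.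
   Context: Layered graph. $G=(V,E)$ is a finite layered DAG, $V=\bigcup_{l=0}^L V_l$, edges go only from a layer to the next; $\mathrm{pa}(v)\subseteq V_{l-1}$ and $\mathrm{ch}(v)\subseteq V_{l+1}$ denote the parents and children of $v\in V_l$. Nodes in $V_0$ are input nodes, nodes in $V_L$ are terminal nodes. Each node $v$ carries a random vector $\mathbf x_v\in\mathbb R^{d_v}$. Input variables $(\mathbf x_v)_{v\in V_0}$ are drawn from an external distribution, and for input nodes $\mathbf z_v:=\mathbf x_v$. For a non-input node, $\mathbf x_v=f_v(\mathbf z_v;\theta_v)$ with $f_v$ differentiable, $\theta_v$ a local (deterministic) parameter vector, and local observation $\mathbf z_v:=((\mathbf x_{v^-})_{v^-\in \mathrm{pa}(v)},\xi_v)$, where $\xi_v$ is an optional auxiliary random variable, independent of everything else. All random variables are assumed to have finite second moments. Backpropagation. Each terminal node $v\in V_L$ is given an external random feedback vector $\mathbf g_v\in\mathbb R^{d_v}$. For a non-terminal node, $\mathbf g_v=\sum_{v^+\in \mathrm{ch}(v)}\mathbf J_v^{v^+}\mathbf g_{v^+}$, where $\mathbf J_v^{v^+}:=(\partial \mathbf x_{v^+}/\partial \mathbf x_v)^\top$ is the transposed Jacobian of the local computation at $v^+$ (a function of $\mathbf z_{v^+}$). For a non-input node, $\mathbf g_v^\theta:=\mathbf J_v^\theta \mathbf g_v$ with $\mathbf J_v^\theta:=(\partial \mathbf x_v/\partial\theta_v)^\top$ (a function of $\mathbf z_v$). Synthetic gradient propagation. For each edge $v\to v^+$, $\tilde{\mathbf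 h}_v^{v^+}\in\mathbb R^{d_v}$ is a synthetic gradient generated locally by $v^+$ for $v$. Each node uses one mixing weight $\lambda_v\in[0,1]$ for all its children. Set $\tilde{\mathbf g}_v:=\mathbf g_v$ for $v\in V_L$, and $\tilde{\mathbf g}_v:=\sum_{v^+\in \mathrm{ch}(v)}\bigl(\lambda_v\mathbf J_v^{v^+}\tilde{\mathbf g}_{v^+}+(1-\lambda_v)\tilde{\mathbf h}_v^{v^+}\bigr)$ otherwise; for non-input $v$, $\tilde{\mathbf g}_v^\theta:=\mathbf J_v^\theta\tilde{\mathbf g}_v$. Extended ancestors. For a non-input node $v\in V_l$, $\mathrm{sib}(v):=\{v'\in V_l:\mathrm{pa}(v')\cap \mathrm{pa}(v)\ne\varnothing\}$ (with $v$ itself included). Define recursively $\mathrm{an}_{\mathrm{sib}}(v):=\bigl(\bigcup_{v^-\in \mathrm{pa}(\mathrm{sib}(v))}\mathrm{an}_{\mathrm{sib}}(v^-)\bigr)\cup \mathrm{sib}(v)$, where $\mathrm{pa}(\mathrm{sib}(v))$ is the set of all parents of nodes in $\mathrm{sib}(v)$ and $\mathrm{an}_{\mathrm{sib}}(v):=\varnothing$ for input nodes. For $U\subseteq V$, $\mathbf Z_U:=\{\mathbf z_u:u\in U\}$. $\|\cdot\|_2$ is the Euclidean norm of vectors and the spectral norm of matrices; $\operatorname{tr}\operatorname{Cov}(\mathbf y)=\mathbb E\|\mathbf y-\mathbb E\mathbf y\|_2^2$. *)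

theory Defs
  imports "HOL-Probability.Probability"
begin

text \<open>
  Nodes are the elements of a finite type; \<open>layer v\<close> is the index of the layer containing \<open>v\<close>.
\<close>

locale layered_graph =
  fixes E :: "('v::finite \<times> 'v) set" and layer :: "'v \<Rightarrow> nat" and L :: nat
  assumes layer_le: "layer v \<le> L"
    and edge_layer: "(u, v) \<in> E \<Longrightarrow> layer v = Suc (layer u)"

definition pa :: "('v \<times> 'v) set \<Rightarrow> 'v \<Rightarrow> 'v set" where
  "pa E v = {u. (u, v) \<in> E}"

definition ch :: "('v \<times> 'v) set \<Rightarrow> 'v \<Rightarrow> 'v set" where
  "ch E v = {w. (v, w) \<in> E}"

definition sib :: "('v \<times> 'v) set \<Rightarrow> ('v \<Rightarrow> nat) \<Rightarrow> 'v \<Rightarrow> 'v set" where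
  "sib E layer v = insert v {v'. layer v' = layer v \<and> pa E v' \<inter> pa E v \<noteq> {}}"

text \<open>
  The recursion for extended ancestors runs down the layers: for \<open>v\<close> in layer \<open>Suc l\<close>, the parents
  of its siblings are all in layer \<open>l\<close>.
\<close>

primrec an_sib_at :: "('v \<times> 'v) set \<Rightarrow> ('v \<Rightarrow> nat) \<Rightarrow> nat \<Rightarrow> 'v \<Rightarrow> 'v set" where
  "an_sib_at E layer 0 v = {}"
| "an_sib_at E layer (Suc l) v =
     (\<Union>u \<in> (\<Union>v' \<in> sib E layer v. pa E v'). an_sib_at E layer l u) \<union> sib E layer v"

definition an_sib :: "('v \<times> 'v) set \<Rightarrow> ('v \<Rightarrow> nat) \<Rightarrow> 'v \<Rightarrow> 'v set" where
  "an_sib E layer v = an_sib_at E layer (layer v) v"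

text \<open>
  Node dimensions vary, so the space of dimension \<open>d\<close> attached to a node is realised as the
  subspace of \<open>real ^ 'c\<close> of vectors vanishing off a set of \<open>d\<close> coordinates. As there are finitely
  many nodes and \<open>'c\<close> is arbitrary, every family of dimensions arises. Zero padding changes neither
  Euclidean norms of vectors nor spectral norms of Jacobians.
\<close>

definition coord_space :: "'c set \<Rightarrow> (real ^ 'c) set" where
  "coord_space C = {y. \<forall>i. i \<notin> C \<longrightarrow> y $ i = 0}"

definition spectral_norm :: "real ^ 'c ^ 'r \<Rightarrow> real" where
  "spectral_norm A = onorm (\<lambda>y. A *v y)"

definition square_integrable :: "'w measure \<Rightarrow> ('w \<Rightarrow> real ^ 'c) \<Rightarrow> bool" where
  "square_integrable M X \<longleftrightarrow>
     X \<in> borel_measurable M \<and> integrable M (\<lambda>\<omega>. (norm (X \<omega>))\<^sup>2)"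

definition tr_cov :: "'w measure \<Rightarrow> ('w \<Rightarrow> real ^ 'c) \<Rightarrow> real" where
  "tr_cov M X = (\<integral>\<omega>. (norm (X \<omega> - (\<integral>\<omega>'. X \<omega>' \<partial>M)))\<^sup>2 \<partial>M)"

definition vec_cond_exp ::
    "'w measure \<Rightarrow> 'w measure \<Rightarrow> ('w \<Rightarrow> real ^ 'c) \<Rightarrow> 'w \<Rightarrow> real ^ 'c" where
  "vec_cond_exp M F X \<omega> = (\<chi> i. real_cond_exp M F (\<lambda>\<omega>'. X \<omega>' $ i) \<omega>)"

text \<open>
  The sigma-algebra generated by the observations of the non-input nodes in \<open>S\<close>.
\<close>

definition obs_algebra ::
    "'w measure \<Rightarrow> ('v \<Rightarrow> 'e measure) \<Rightarrow> ('v \<Rightarrow> 'w \<Rightarrow> ((real ^ 'c) ^ 'v::finite) \<times> 'e)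
      \<Rightarrow> 'v set \<Rightarrow> 'w measure" where
  "obs_algebra M \<Xi> z S =
     sigma (space M) (\<Union>w\<in>S. sets (vimage_algebra (space M) (z w) (borel \<Otimes>\<^sub>M \<Xi> w)))"

text \<open>
  A local observation is a pair \<open>(y, e)\<close>: \<open>y $ u\<close> is the value of parent \<open>u\<close> (zero if \<open>u\<close> is not a
  parent) and \<open>e\<close> is the auxiliary variable, with values in the measurable space \<open>\<Xi> v\<close>. A node
  without auxiliary variable has a one-point \<open>\<Xi> v\<close>.
\<close>

definition input_jac ::
    "('v::finite \<Rightarrow> ((real ^ 'c) ^ 'v) \<times> 'e \<Rightarrow> real ^ 'p \<Rightarrow> real ^ 'c) \<Rightarrow> ('v \<Rightarrow> real ^ 'p)
      \<Rightarrow> 'v \<Rightarrow> 'v \<Rightarrow> ((real ^ 'c) ^ 'v) \<times> 'e \<Rightarrow> real ^ 'c ^ 'c" where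
  "input_jac f \<theta> u v z =
     transpose (jacobian (\<lambda>a. f v (\<chi> w. if w = u then a else fst z $ w, snd z) (\<theta> v))
       (at (fst z $ u)))"

definition param_jac ::
    "('v::finite \<Rightarrow> ((real ^ 'c) ^ 'v) \<times> 'e \<Rightarrow> real ^ 'p \<Rightarrow> real ^ 'c) \<Rightarrow> ('v \<Rightarrow> real ^ 'p)
      \<Rightarrow> 'v \<Rightarrow> ((real ^ 'c) ^ 'v) \<times> 'e \<Rightarrow> real ^ 'c ^ 'p" where
  "param_jac f \<theta> v z = transpose (jacobian (f v z) (at (\<theta> v)))"

text \<open>
  \<open>C v\<close> and \<open>P v\<close> are the coordinate sets of the value and of the parameter of \<open>v\<close>; only the
  relevant coordinates enter \<open>f v\<close>. The auxiliary variables are mutually independent and jointly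
  independent of the family of inputs, whose joint law is arbitrary.
\<close>

locale layered_model = prob_space M + layered_graph E layer L
  for M :: "'w measure" and E :: "('v::finite \<times> 'v) set" and layer :: "'v \<Rightarrow> nat" and L :: nat +
  fixes C :: "'v \<Rightarrow> 'c::finite set" and P :: "'v \<Rightarrow> 'p::finite set"
    and \<Xi> :: "'v \<Rightarrow> 'e measure" and \<xi> :: "'v \<Rightarrow> 'w \<Rightarrow> 'e"
    and f :: "'v \<Rightarrow> ((real ^ 'c) ^ 'v) \<times> 'e \<Rightarrow> real ^ 'p \<Rightarrow> real ^ 'c"
    and \<theta> :: "'v \<Rightarrow> real ^ 'p"
    and x :: "'v \<Rightarrow> 'w \<Rightarrow> real ^ 'c"
    and z :: "'v \<Rightarrow> 'w \<Rightarrow> ((real ^ 'c) ^ 'v) \<times> 'e"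
  assumes x_square_integrable: "square_integrable M (x v)"
    and x_coord: "\<omega> \<in> space M \<Longrightarrow> x v \<omega> \<in> coord_space (C v)"
    and \<theta>_coord: "layer v \<noteq> 0 \<Longrightarrow> \<theta> v \<in> coord_space (P v)"
    and \<xi>_measurable: "layer v \<noteq> 0 \<Longrightarrow> \<xi> v \<in> measurable M (\<Xi> v)"
    and \<xi>_indep:
      "indep_sets
         (\<lambda>j. case j of
            None \<Rightarrow> sigma_sets (space M)
              (\<Union>u\<in>{u. layer u = 0}. sets (vimage_algebra (space M) (x u) borel))
          | Some v \<Rightarrow> sets (vimage_algebra (space M) (\<xi> v) (\<Xi> v)))
         (insert None (Some ` {v. layer v \<noteq> 0}))"
    and f_coord: "layer v \<noteq> 0 \<Longrightarrow> e \<in> space (\<Xi> v) \<Longrightarrow> f v (y, e) t \<in> coord_space (C v)"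
    and f_local: "layer v \<noteq> 0 \<Longrightarrow> e \<in> space (\<Xi> v) \<Longrightarrow>
      (\<And>u i. u \<in> pa E v \<Longrightarrow> i \<in> C u \<Longrightarrow> y $ u $ i = y' $ u $ i) \<Longrightarrow>
      (\<And>j. j \<in> P v \<Longrightarrow> t $ j = t' $ j) \<Longrightarrow> f v (y, e) t = f v (y', e) t'"
    and f_measurable:
      "layer v \<noteq> 0 \<Longrightarrow> (\<lambda>a. f v a t) \<in> borel_measurable (borel \<Otimes>\<^sub>M \<Xi> v)"
    and f_differentiable: "layer v \<noteq> 0 \<Longrightarrow> e \<in> space (\<Xi> v) \<Longrightarrow>
      (\<lambda>(y, t). f v (y, e) t) differentiable (at a)"
    and z_eq: "layer v \<noteq> 0 \<Longrightarrow> \<omega> \<in> space M \<Longrightarrow>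
      z v \<omega> = (\<chi> u. if u \<in> pa E v then x u \<omega> else 0, \<xi> v \<omega>)"
    and x_eq: "layer v \<noteq> 0 \<Longrightarrow> \<omega> \<in> space M \<Longrightarrow> x v \<omega> = f v (z v \<omega>) (\<theta> v)"

text \<open>
  A sequence \<open>W\<close> of independent draws from \<open>M\<close>, defined on a probability space \<open>N\<close>.
\<close>

definition iid_draws :: "'s measure \<Rightarrow> 'w measure \<Rightarrow> nat \<Rightarrow> (nat \<Rightarrow> 's \<Rightarrow> 'w) \<Rightarrow> bool" where
  "iid_draws N M n W \<longleftrightarrow>
     prob_space N \<and> prob_space.indep_vars N (\<lambda>_. M) W {..<n} \<and> (\<forall>i<n. distr N M (W i) = M)"

definition empirical_mean ::
    "nat \<Rightarrow> (nat \<Rightarrow> 's \<Rightarrow> 'w) \<Rightarrow> ('w \<Rightarrow> real ^ 'c) \<Rightarrow> 's \<Rightarrow> real ^ 'c" where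
  "empirical_mean n W X \<sigma> = (1 / real n) *\<^sub>R (\<Sum>i<n. X (W i \<sigma>))"

definition mixing_mse ::
    "'s measure \<Rightarrow> nat \<Rightarrow> (nat \<Rightarrow> 's \<Rightarrow> 'w) \<Rightarrow> ('w \<Rightarrow> real ^ 'c) \<Rightarrow> ('w \<Rightarrow> real ^ 'c)
      \<Rightarrow> real ^ 'c \<Rightarrow> real \<Rightarrow> real" where
  "mixing_mse N n W p s m l =
     (\<integral>\<sigma>. (norm (l *\<^sub>R empirical_mean n W p \<sigma> + (1 - l) *\<^sub>R empirical_mean n W s \<sigma> - m))\<^sup>2 \<partial>N)"

definition optimal_weight ::
    "'w measure \<Rightarrow> 's measure \<Rightarrow> nat \<Rightarrow> (nat \<Rightarrow> 's \<Rightarrow> 'w) \<Rightarrow> ('w \<Rightarrow> real ^ 'c) \<Rightarrow> ('w \<Rightarrow> real ^ 'c)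
      \<Rightarrow> real ^ 'c \<Rightarrow> real" where
  "optimal_weight M N n W p s m =
     (if AE \<omega> in M. p \<omega> = s \<omega> then 0 else arg_min_on (mixing_mse N n W p s m) {0..1})"

end

theory Submission
  imports Defs
begin

text \<open>
  The error at \<open>l = 1\<close> is at least \<open>tr Cov p / n\<close>, the error at \<open>l = 0\<close> is \<open>tr Cov s / n\<close> plus the squared
  bias of \<open>s\<close>. So it suffices to bound this bias by \<open>J\<^sup>2 (\<epsilon> + \<epsilon>') \<Sum>\<^sub>w (1 + c w)\<close>. It is the mean of
  \<open>J\<theta> \<Sum>\<^sub>w J\<^sub>w (h w - g w)\<close>, where each \<open>J\<^sub>w\<close> is a function of the observation at \<open>w\<close>. Replacing \<open>h w\<close> by
  \<open>E[g' w | z w]\<close> costs \<open>\<epsilon>'\<close>, replacing \<open>E[g w | z w]\<close> by the expectation given also \<open>z v\<close> costs \<open>\<epsilon>\<close>, and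
  the distance between \<open>E[g' w | z w]\<close> and \<open>E[g w | z w]\<close> is at most \<open>c w (\<epsilon> + \<epsilon>')\<close>, by induction from
  the terminal layer downwards. The induction needs the last bound conditionally on \<open>z w\<close> and any
  further observations of extended ancestors of \<open>w\<close>, because the observation of a parent \<open>u\<close> is added
  at each step before the Jacobian of the edge to \<open>w\<close> is split off.
\<close>

section \<open>Weak bounds on conditional expectations\<close>

text \<open>
  A dual form of the almost sure bound \<open>B\<close> on the norm of the conditional expectation of \<open>X\<close>
  given \<open>F\<close>; it passes through matrix factors without pulling them out of a conditional expectation.
\<close>

definition cond_norm_le :: "'w measure \<Rightarrow> 'w measure \<Rightarrow> ('w \<Rightarrow> 'a::euclidean_space) \<Rightarrow> real \<Rightarrow> bool"
  where "cond_norm_le M F X B \<longleftrightarrow>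
    (\<forall>Y K. Y \<in> borel_measurable F \<longrightarrow> (AE \<omega> in M. norm (Y \<omega>) \<le> K) \<longrightarrow>
      (\<integral>\<omega>. X \<omega> \<bullet> Y \<omega> \<partial>M) \<le> B * (\<integral>\<omega>. norm (Y \<omega>) \<partial>M))"

lemma cond_norm_leI:
  assumes "\<And>Y K. Y \<in> borel_measurable F \<Longrightarrow> AE \<omega> in M. norm (Y \<omega>) \<le> K \<Longrightarrow>
      (\<integral>\<omega>. X \<omega> \<bullet> Y \<omega> \<partial>M) \<le> B * (\<integral>\<omega>. norm (Y \<omega>) \<partial>M)"
  shows "cond_norm_le M F X B"
  using assms unfolding cond_norm_le_def by blast

lemma cond_norm_leD:
  assumes "cond_norm_le M F X B" "Y \<in> borel_measurable F" "AE \<omega> in M. norm (Y \<omega>) \<le> K"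
  shows "(\<integral>\<omega>. X \<omega> \<bullet> Y \<omega> \<partial>M) \<le> B * (\<integral>\<omega>. norm (Y \<omega>) \<partial>M)"
  using assms unfolding cond_norm_le_def by blast

text \<open>Test vectors are bounded by some \<open>K\<close>, so pairing them with a merely
  integrable \<open>X\<close> gives a finite integral, by Cauchy-Schwarz.\<close>

lemma integrable_inner_AE_bounded:
  fixes X Y :: "'w \<Rightarrow> 'a::euclidean_space"
  assumes X: "integrable M X" and [measurable]: "Y \<in> borel_measurable M"
    and "AE \<omega> in M. norm (Y \<omega>) \<le> K"
  shows "integrable M (\<lambda>\<omega>. X \<omega> \<bullet> Y \<omega>)"
proof (rule Bochner_Integration.integrable_bound)
  have [measurable]: "X \<in> borel_measurable M" using X by simp
  show "integrable M (\<lambda>\<omega>. K * norm (X \<omega>))" using X by simp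
  show "(\<lambda>\<omega>. X \<omega> \<bullet> Y \<omega>) \<in> borel_measurable M" by measurable
  show "AE \<omega> in M. norm (X \<omega> \<bullet> Y \<omega>) \<le> norm (K * norm (X \<omega>))"
    using assms(3)
  proof eventually_elim
    case (elim \<omega>)
    have "\<bar>X \<omega> \<bullet> Y \<omega>\<bar> \<le> norm (X \<omega>) * norm (Y \<omega>)" by (rule Cauchy_Schwarz_ineq2)
    also have "\<dots> \<le> norm (X \<omega>) * K" using elim by (intro mult_left_mono) auto
    also have "\<dots> \<le> norm (K * norm (X \<omega>))" by (simp add: mult.commute)
    finally show ?case by simp
  qed
qed

lemma (in prob_space) integrable_AE_bounded:
  fixes Y :: "'a \<Rightarrow> 'b::euclidean_space"
  assumes "Y \<in> borel_measurable M" "AE \<omega> in M. norm (Y \<omega>) \<le> K"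
  shows "integrable M Y"
  using assms by (intro integrable_const_bound[of Y K]) auto

text \<open>A coarser sigma-algebra admits fewer test vectors. This replaces the tower property
  combined with Jensen's inequality.\<close>

lemma cond_norm_le_subalgebra:
  assumes "cond_norm_le M F' X B" "subalgebra F' F"
  shows "cond_norm_le M F X B"
  by (meson assms cond_norm_leD cond_norm_leI measurable_from_subalg)

lemma cond_norm_le_scaleR:
  assumes "cond_norm_le M F X B" "0 \<le> a"
  shows "cond_norm_le M F (\<lambda>\<omega>. a *\<^sub>R X \<omega>) (a * B)"
proof (rule cond_norm_leI)
  fix Y :: "'a \<Rightarrow> 'b" and K assume "Y \<in> borel_measurable F" "AE \<omega> in M. norm (Y \<omega>) \<le> K"
  from mult_left_mono[OF cond_norm_leD[OF assms(1) this] assms(2)]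
  show "(\<integral>\<omega>. (a *\<^sub>R X \<omega>) \<bullet> Y \<omega> \<partial>M) \<le> (a * B) * (\<integral>\<omega>. norm (Y \<omega>) \<partial>M)"
    by (simp add: mult.assoc)
qed

lemma cond_norm_le_add:
  assumes X: "integrable M X" "integrable M X'" and F: "subalgebra M F"
    and b: "cond_norm_le M F X B" "cond_norm_le M F X' B'"
  shows "cond_norm_le M F (\<lambda>\<omega>. X \<omega> + X' \<omega>) (B + B')"
proof (rule cond_norm_leI)
  fix Y :: "'a \<Rightarrow> 'b" and K assume Y: "Y \<in> borel_measurable F" "AE \<omega> in M. norm (Y \<omega>) \<le> K"
  note i = integrable_inner_AE_bounded[OF _ measurable_from_subalg[OF F Y(1)] Y(2)]
  have "(\<integral>\<omega>. (X \<omega> + X' \<omega>) \<bullet> Y \<omega> \<partial>M) = (\<integral>\<omega>. X \<omega> \<bullet> Y \<omega> \<partial>M) + (\<integral>\<omega>. X' \<omega> \<bullet> Y \<omega> \<partial>M)"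
    using i[OF X(1)] i[OF X(2)] by (simp add: inner_add_left)
  then show "(\<integral>\<omega>. (X \<omega> + X' \<omega>) \<bullet> Y \<omega> \<partial>M) \<le> (B + B') * (\<integral>\<omega>. norm (Y \<omega>) \<partial>M)"
    using cond_norm_leD[OF b(1) Y] cond_norm_leD[OF b(2) Y] by (simp add: algebra_simps)
qed

lemma cond_norm_le_sum:
  assumes "finite I" "\<And>i. i \<in> I \<Longrightarrow> integrable M (X i)" "subalgebra M F"
    and "\<And>i. i \<in> I \<Longrightarrow> cond_norm_le M F (X i) (B i)"
  shows "cond_norm_le M F (\<lambda>\<omega>. \<Sum>i\<in>I. X i \<omega>) (\<Sum>i\<in>I. B i)"
  using assms
proof (induction I rule: finite_induct)
  case empty
  show ?case by (rule cond_norm_leI) simp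
next
  case (insert i I)
  then show ?case by (auto intro!: cond_norm_le_add)
qed

lemma cond_norm_le_cong_AE:
  assumes "cond_norm_le M F X B" "AE \<omega> in M. X \<omega> = X' \<omega>" "subalgebra M F"
    and [measurable]: "X \<in> borel_measurable M" "X' \<in> borel_measurable M"
  shows "cond_norm_le M F X' B"
proof (rule cond_norm_leI)
  fix Y :: "'a \<Rightarrow> 'b" and K assume Y: "Y \<in> borel_measurable F" "AE \<omega> in M. norm (Y \<omega>) \<le> K"
  have [measurable]: "Y \<in> borel_measurable M" using measurable_from_subalg[OF assms(3) Y(1)] .
  have "(\<integral>\<omega>. X' \<omega> \<bullet> Y \<omega> \<partial>M) = (\<integral>\<omega>. X \<omega> \<bullet> Y \<omega> \<partial>M)"
    using assms(2) by (intro integral_cong_AE) auto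
  then show "(\<integral>\<omega>. X' \<omega> \<bullet> Y \<omega> \<partial>M) \<le> B * (\<integral>\<omega>. norm (Y \<omega>) \<partial>M)"
    using cond_norm_leD[OF assms(1) Y] by simp
qed

lemma (in prob_space) cond_norm_le_AE_bounded:
  assumes X: "integrable M X" and F: "subalgebra M F" and b: "AE \<omega> in M. norm (X \<omega>) \<le> B"
  shows "cond_norm_le M F X B"
proof (rule cond_norm_leI)
  fix Y :: "'a \<Rightarrow> 'b" and K assume Y: "Y \<in> borel_measurable F" "AE \<omega> in M. norm (Y \<omega>) \<le> K"
  note YM = measurable_from_subalg[OF F Y(1)]
  have "(\<integral>\<omega>. X \<omega> \<bullet> Y \<omega> \<partial>M) \<le> (\<integral>\<omega>. B * norm (Y \<omega>) \<partial>M)"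
  proof (rule integral_mono_AE)
    show "integrable M (\<lambda>\<omega>. X \<omega> \<bullet> Y \<omega>)" by (rule integrable_inner_AE_bounded[OF X YM Y(2)])
    show "integrable M (\<lambda>\<omega>. B * norm (Y \<omega>))" using integrable_AE_bounded[OF YM Y(2)] by simp
    show "AE \<omega> in M. X \<omega> \<bullet> Y \<omega> \<le> B * norm (Y \<omega>)"
      using b
    proof eventually_elim
      case (elim \<omega>)
      have "X \<omega> \<bullet> Y \<omega> \<le> norm (X \<omega>) * norm (Y \<omega>)" by (rule norm_cauchy_schwarz)
      also have "\<dots> \<le> B * norm (Y \<omega>)" using elim by (intro mult_right_mono) auto
      finally show ?case .
    qed
  qed
  then show "(\<integral>\<omega>. X \<omega> \<bullet> Y \<omega> \<partial>M) \<le> B * (\<integral>\<omega>. norm (Y \<omega>) \<partial>M)" by simp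
qed

text \<open>Since \<open>Z\<close> is itself measurable for \<open>F\<close>, its own direction is
  an admissible test vector. This is the way back from the dual form to a pointwise bound.\<close>

lemma (in prob_space) AE_bounded_cond_norm_le:
  fixes Z :: "'a \<Rightarrow> 'b::euclidean_space"
  assumes b: "cond_norm_le M F Z B" and F: "subalgebra M F"
    and Z: "Z \<in> borel_measurable F" "integrable M Z"
  shows "AE \<omega> in M. norm (Z \<omega>) \<le> B"
proof -
  \<comment> \<open>test against the direction of \<open>Z\<close> on the event that the bound fails\<close>
  define Y where "Y \<omega> = (if norm (Z \<omega>) > B then sgn (Z \<omega>) else 0)" for \<omega>
  have sg: "sgn = (\<lambda>y::'b. inverse (norm y) *\<^sub>R y)" by (simp add: sgn_div_norm fun_eq_iff)
  have Y: "Y \<in> borel_measurable F" using Z(1) unfolding Y_def sg by measurable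
  note YM = measurable_from_subalg[OF F Y]
  have Y1: "AE \<omega> in M. norm (Y \<omega>) \<le> 1" by (simp add: Y_def norm_sgn)
  have i: "integrable M (\<lambda>\<omega>. Z \<omega> \<bullet> Y \<omega>)" "integrable M (\<lambda>\<omega>. norm (Y \<omega>))"
    using integrable_inner_AE_bounded[OF Z(2) YM Y1] integrable_AE_bounded[OF YM Y1] by auto
  \<comment> \<open>\<open>D\<close> is nonnegative everywhere, while the hypothesis makes its
    integral nonpositive; hence it vanishes almost surely. Where \<open>Z\<close> is nonzero, this
    is the claimed bound.\<close>
  define D where "D \<omega> = Z \<omega> \<bullet> Y \<omega> - B * norm (Y \<omega>)" for \<omega>
  have ip: "a \<bullet> sgn a = norm a" for a :: 'b
    by (cases "a = 0") (auto simp: sgn_div_norm dot_square_norm power2_eq_square)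
  have D: "D \<omega> = (if norm (Z \<omega>) > B then norm (Z \<omega>) - B * norm (sgn (Z \<omega>)) else 0)" for \<omega>
    by (simp add: D_def Y_def ip)
  have D0: "0 \<le> D \<omega>" for \<omega> by (auto simp: D norm_sgn)
  have "(\<integral>\<omega>. D \<omega> \<partial>M) \<le> 0"
    using cond_norm_leD[OF b Y Y1] i by (simp add: D_def)
  moreover have iD: "integrable M D" using i unfolding D_def by simp
  ultimately have "(\<integral>\<omega>. D \<omega> \<partial>M) = 0" using D0 by (simp add: integral_nonneg antisym)
  then have "AE \<omega> in M. D \<omega> = 0"
    using integral_nonneg_eq_0_iff_AE[OF iD] D0 by simp
  \<comment> \<open>Where \<open>Z\<close> is zero its direction is zero too, and \<open>D\<close>
    carries no information; the bound there says \<open>B \<ge> 0\<close>. For negative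
    \<open>B\<close>, testing with a constant unit vector and with its negative gives contradictory
    signs.\<close>
  moreover have "B \<ge> 0"
  proof (rule ccontr)
    assume "\<not> B \<ge> 0"
    obtain e :: 'b where e: "norm e = 1" using vector_choose_size[of 1] by auto
    have "(\<integral>\<omega>. Z \<omega> \<bullet> e \<partial>M) \<le> B" "(\<integral>\<omega>. Z \<omega> \<bullet> - e \<partial>M) \<le> B"
      using cond_norm_leD[OF b, of "\<lambda>_. e" 1] cond_norm_leD[OF b, of "\<lambda>_. - e" 1] e
      by (simp_all add: prob_space)
    then show False using \<open>\<not> B \<ge> 0\<close> by simp
  qed
  ultimately show ?thesis
    by (auto simp: D norm_sgn split: if_splits elim!: eventually_mono)
qed

text \<open>Constants are measurable for every \<open>F\<close>, so the unit vector in the direction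
  of the mean is a legitimate test.\<close>

lemma (in prob_space) norm_expectation_le:
  fixes X :: "'a \<Rightarrow> 'b::euclidean_space"
  assumes "cond_norm_le M F X B" "integrable M X"
  shows "norm (\<integral>\<omega>. X \<omega> \<partial>M) \<le> B"
proof -
  \<comment> \<open>If the mean is zero, any unit vector will do; \<open>e\<close> must have norm 1
    in this case too, so that the test returns exactly \<open>B\<close> on the right.\<close>
  obtain e where e: "norm e = 1" "norm (\<integral>\<omega>. X \<omega> \<partial>M) = (\<integral>\<omega>. X \<omega> \<partial>M) \<bullet> e"
  proof (cases "(\<integral>\<omega>. X \<omega> \<partial>M) = 0")
    case True
    then show ?thesis using that vector_choose_size[of 1] by auto
  next
    case False
    then show ?thesis
      using that[of "sgn (\<integral>\<omega>. X \<omega> \<partial>M)"]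
      by (simp add: norm_sgn) (simp add: sgn_div_norm dot_square_norm power2_eq_square)
  qed
  have "(\<integral>\<omega>. X \<omega> \<bullet> e \<partial>M) \<le> B"
    using cond_norm_leD[OF assms(1), of "\<lambda>_. e" 1] e by (simp add: prob_space)
  then show ?thesis using e assms(2) by simp
qed

section \<open>Random matrices\<close>

lemma borel_measurable_vec_iff:
  fixes X :: "'w \<Rightarrow> real ^ 'n"
  shows "X \<in> borel_measurable M \<longleftrightarrow> (\<forall>i. (\<lambda>\<omega>. X \<omega> $ i) \<in> borel_measurable M)"
  by (subst borel_measurable_euclidean_space) (auto simp: Basis_vec_def inner_axis)

lemma borel_measurable_matrix_vector:
  fixes A :: "'w \<Rightarrow> real ^ 'n ^ 'm"
  assumes A: "\<And>i j. (\<lambda>\<omega>. A \<omega> $ i $ j) \<in> borel_measurable M" and X: "X \<in> borel_measurable M"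
  shows "(\<lambda>\<omega>. A \<omega> *v X \<omega>) \<in> borel_measurable M"
  using X A unfolding borel_measurable_vec_iff matrix_vector_mult_def
  by (auto intro!: borel_measurable_sum borel_measurable_times)

lemma norm_matrix_vector_le:
  fixes A :: "real ^ 'n ^ 'm"
  assumes "spectral_norm A \<le> J"
  shows "norm (A *v y) \<le> J * norm y"
proof -
  have "norm (A *v y) \<le> spectral_norm A * norm y"
    unfolding spectral_norm_def by (rule onorm) simp
  also have "\<dots> \<le> J * norm y" using assms by (intro mult_right_mono) auto
  finally show ?thesis .
qed

text \<open>A matrix and its transpose have the same spectral norm: the squared norm of
  \<open>transpose A *v y\<close> is the inner product of \<open>y\<close> with \<open>A\<close>
  applied to it. Moving a Jacobian onto the test vector uses this.\<close>

lemma norm_transpose_vector_le: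
  fixes A :: "real ^ 'n ^ 'm"
  assumes "spectral_norm A \<le> J"
  shows "norm (transpose A *v y) \<le> J * norm y"
proof -
  let ?w = "transpose A *v y"
  have "norm ?w * norm ?w = y \<bullet> (A *v ?w)"
    by (metis dot_lmul_matrix norm_eq_sqrt_inner real_sqrt_mult_self abs_of_nonneg inner_ge_zero
        transpose_matrix_vector)
  also have "\<dots> \<le> norm y * (J * norm ?w)"
    using norm_cauchy_schwarz[of y "A *v ?w"] norm_matrix_vector_le[OF assms, of ?w]
    by (meson mult_left_mono norm_ge_zero order_trans)
  finally have *: "norm ?w * norm ?w \<le> (J * norm y) * norm ?w" by (simp add: mult_ac)
  show ?thesis
  \<comment> \<open>Cancelling \<open>norm ?w\<close> requires it to be nonzero. If it is zero, only
    \<open>J \<ge> 0\<close> is left to show, which follows by applying \<open>A\<close> to a basis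
    vector.\<close>
  proof (cases "?w = 0")
    case True
    have "0 \<le> norm (A *v axis undefined 1)" by simp
    also have "\<dots> \<le> J" using norm_matrix_vector_le[OF assms, of "axis undefined 1"] by simp
    finally show ?thesis using True by simp
  next
    case False
    then show ?thesis using * by simp
  qed
qed

lemma square_integrable_matrix_vector:
  fixes A :: "'w \<Rightarrow> real ^ 'n ^ 'm"
  assumes A: "\<And>i j. (\<lambda>\<omega>. A \<omega> $ i $ j) \<in> borel_measurable M"
    and J: "AE \<omega> in M. spectral_norm (A \<omega>) \<le> J" and X: "square_integrable M X"
  shows "square_integrable M (\<lambda>\<omega>. A \<omega> *v X \<omega>)"
proof -
  have [measurable]: "(\<lambda>\<omega>. A \<omega> *v X \<omega>) \<in> borel_measurable M"
    using A X by (auto simp: square_integrable_def intro: borel_measurable_matrix_vector)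
  have "integrable M (\<lambda>\<omega>. (norm (A \<omega> *v X \<omega>))\<^sup>2)"
  proof (rule Bochner_Integration.integrable_bound)
    show "integrable M (\<lambda>\<omega>. J\<^sup>2 * (norm (X \<omega>))\<^sup>2)" using X by (simp add: square_integrable_def)
    show "AE \<omega> in M. norm ((norm (A \<omega> *v X \<omega>))\<^sup>2) \<le> norm (J\<^sup>2 * (norm (X \<omega>))\<^sup>2)"
      using J
    proof eventually_elim
      case (elim \<omega>)
      from power_mono[OF norm_matrix_vector_le[OF elim, of "X \<omega>"], of 2]
      show ?case by (simp add: power_mult_distrib)
    qed
  qed measurable
  then show ?thesis by (simp add: square_integrable_def)
qed

lemma (in prob_space) integrable_if_square_integrable:
  assumes "square_integrable M X"
  shows "integrable M X"
proof (rule Bochner_Integration.integrable_bound)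
  show "integrable M (\<lambda>\<omega>. 1 + (norm (X \<omega>))\<^sup>2)" "X \<in> borel_measurable M"
    using assms by (auto simp: square_integrable_def)
  have "a \<le> 1 + a\<^sup>2" for a :: real
    using zero_le_power2[of "a - 1 / 2"] by (simp add: power2_eq_square algebra_simps)
  then show "AE \<omega> in M. norm (X \<omega>) \<le> norm (1 + (norm (X \<omega>))\<^sup>2)" by simp
qed

lemma square_integrable_add:
  fixes X Y :: "'w \<Rightarrow> real ^ 'n"
  assumes "square_integrable M X" "square_integrable M Y"
  shows "square_integrable M (\<lambda>\<omega>. X \<omega> + Y \<omega>)"
proof -
  have [measurable]: "X \<in> borel_measurable M" "Y \<in> borel_measurable M"
    using assms by (auto simp: square_integrable_def)
  have "integrable M (\<lambda>\<omega>. (norm (X \<omega> + Y \<omega>))\<^sup>2)"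
  proof (rule Bochner_Integration.integrable_bound)
    show "integrable M (\<lambda>\<omega>. 2 * (norm (X \<omega>))\<^sup>2 + 2 * (norm (Y \<omega>))\<^sup>2)"
      using assms by (simp add: square_integrable_def)
    have "(norm (a + b))\<^sup>2 \<le> 2 * (norm a)\<^sup>2 + 2 * (norm b)\<^sup>2" for a b :: "real ^ 'n"
    proof -
      have "(norm (a + b))\<^sup>2 \<le> (norm a + norm b)\<^sup>2" by (intro power_mono norm_triangle_ineq) auto
      also have "\<dots> \<le> 2 * (norm a)\<^sup>2 + 2 * (norm b)\<^sup>2"
        using zero_le_power2[of "norm a - norm b"] by (simp add: power2_eq_square algebra_simps)
      finally show ?thesis .
    qed
    then show "AE \<omega> in M. norm ((norm (X \<omega> + Y \<omega>))\<^sup>2)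
        \<le> norm (2 * (norm (X \<omega>))\<^sup>2 + 2 * (norm (Y \<omega>))\<^sup>2)" by simp
  qed measurable
  then show ?thesis by (simp add: square_integrable_def)
qed

lemma square_integrable_scaleR:
  "square_integrable M X \<Longrightarrow> square_integrable M (\<lambda>\<omega>. a *\<^sub>R X \<omega>)"
  by (auto simp: square_integrable_def power_mult_distrib)

lemma square_integrable_sum:
  fixes X :: "'i \<Rightarrow> 'w \<Rightarrow> real ^ 'n"
  assumes "finite I" "\<And>i. i \<in> I \<Longrightarrow> square_integrable M (X i)"
  shows "square_integrable M (\<lambda>\<omega>. \<Sum>i\<in>I. X i \<omega>)"
  using assms
proof (induction I rule: finite_induct)
  case empty
  show ?case by (simp add: square_integrable_def)
next
  case (insert i I)
  then show ?case by (auto intro: square_integrable_add)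
qed

lemma integrable_matrix_vector:
  fixes A :: "'w \<Rightarrow> real ^ 'n ^ 'm"
  assumes A: "\<And>i j. (\<lambda>\<omega>. A \<omega> $ i $ j) \<in> borel_measurable M"
    and J: "AE \<omega> in M. spectral_norm (A \<omega>) \<le> J" and X: "integrable M X"
  shows "integrable M (\<lambda>\<omega>. A \<omega> *v X \<omega>)"
proof (rule Bochner_Integration.integrable_bound)
  show "integrable M (\<lambda>\<omega>. J * norm (X \<omega>))" using X by simp
  show "(\<lambda>\<omega>. A \<omega> *v X \<omega>) \<in> borel_measurable M"
    using X A by (intro borel_measurable_matrix_vector) auto
  show "AE \<omega> in M. norm (A \<omega> *v X \<omega>) \<le> norm (J * norm (X \<omega>))"
    using J
  proof eventually_elim
    case (elim \<omega>)
    from norm_matrix_vector_le[OF elim, of "X \<omega>"] show ?case by simp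
  qed
qed

text \<open>The matrix moves to the other side of the inner product as its transpose. As the entries
  of \<open>A\<close> are measurable for \<open>F\<close> and its norm is bounded, the transformed
  test vector is again admissible, and its norm has grown by at most the factor
  \<open>J\<close>.\<close>

lemma (in prob_space) cond_norm_le_matrix_vector:
  fixes A :: "'a \<Rightarrow> real ^ 'n ^ 'm"
  assumes F: "subalgebra M F"
    and A: "\<And>i j. (\<lambda>\<omega>. A \<omega> $ i $ j) \<in> borel_measurable F"
    and J: "AE \<omega> in M. spectral_norm (A \<omega>) \<le> J"
    and b: "cond_norm_le M F X B" "0 \<le> B"
  shows "cond_norm_le M F (\<lambda>\<omega>. A \<omega> *v X \<omega>) (J * B)"
proof (rule cond_norm_leI)
  fix Y :: "'a \<Rightarrow> real ^ 'm" and K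
  assume Y: "Y \<in> borel_measurable F" "AE \<omega> in M. norm (Y \<omega>) \<le> K"
  define Y' where "Y' \<omega> = transpose (A \<omega>) *v Y \<omega>" for \<omega>
  have Y': "Y' \<in> borel_measurable F"
    unfolding Y'_def using A Y(1)
    by (intro borel_measurable_matrix_vector) (auto simp: transpose_def)
  have le: "AE \<omega> in M. norm (Y' \<omega>) \<le> J * norm (Y \<omega>)"
    using J by eventually_elim (simp add: Y'_def norm_transpose_vector_le del: transpose_matrix_vector)
  have le': "AE \<omega> in M. norm (Y' \<omega>) \<le> \<bar>J\<bar> * K"
    using le Y(2)
  proof eventually_elim
    case (elim \<omega>)
    have "J * norm (Y \<omega>) \<le> \<bar>J\<bar> * norm (Y \<omega>)" by (intro mult_right_mono) auto
    also have "\<dots> \<le> \<bar>J\<bar> * K" using elim by (intro mult_left_mono) auto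
    finally show ?case using elim by simp
  qed
  have "(\<integral>\<omega>. (A \<omega> *v X \<omega>) \<bullet> Y \<omega> \<partial>M) = (\<integral>\<omega>. X \<omega> \<bullet> Y' \<omega> \<partial>M)"
    by (intro Bochner_Integration.integral_cong refl)
      (metis Y'_def dot_lmul_matrix inner_commute transpose_matrix_vector)
  also have "\<dots> \<le> B * (\<integral>\<omega>. norm (Y' \<omega>) \<partial>M)" by (rule cond_norm_leD[OF b(1) Y' le'])
  also have "\<dots> \<le> B * (\<integral>\<omega>. J * norm (Y \<omega>) \<partial>M)"
  proof (intro mult_left_mono[OF _ b(2)] integral_mono_AE[OF _ _ le])
    show "integrable M (\<lambda>\<omega>. norm (Y' \<omega>))"
      using integrable_AE_bounded[OF measurable_from_subalg[OF F Y'] le'] by simp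
    show "integrable M (\<lambda>\<omega>. J * norm (Y \<omega>))"
      using integrable_AE_bounded[OF measurable_from_subalg[OF F Y(1)] Y(2)] by simp
  qed
  finally show "(\<integral>\<omega>. (A \<omega> *v X \<omega>) \<bullet> Y \<omega> \<partial>M) \<le> (J * B) * (\<integral>\<omega>. norm (Y \<omega>) \<partial>M)"
    using b(2) by (simp add: mult_ac)
qed

section \<open>Conditional expectations of random vectors\<close>

lemma vec_cond_exp_measurable: "vec_cond_exp M F X \<in> borel_measurable F"
  unfolding borel_measurable_vec_iff by (simp add: vec_cond_exp_def)

lemma integrable_vec_iff:
  fixes X :: "'w \<Rightarrow> real ^ 'n"
  shows "integrable M X \<longleftrightarrow> (\<forall>i. integrable M (\<lambda>\<omega>. X \<omega> $ i))"
proof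
  assume X: "integrable M X"
  have "integrable M (\<lambda>\<omega>. X \<omega> \<bullet> axis i 1)" for i using X by simp
  then show "\<forall>i. integrable M (\<lambda>\<omega>. X \<omega> $ i)" by (simp add: inner_axis)
next
  assume X: "\<forall>i. integrable M (\<lambda>\<omega>. X \<omega> $ i)"
  then have "integrable M (\<lambda>\<omega>. \<Sum>i\<in>UNIV. X \<omega> $ i *\<^sub>R (axis i 1 :: real ^ 'n))"
    by (intro Bochner_Integration.integrable_sum integrable_scaleR_left) auto
  moreover have "(\<lambda>\<omega>. \<Sum>i\<in>UNIV. X \<omega> $ i *\<^sub>R axis i 1) = X"
    using basis_expansion[of "X _"] by (intro ext) (simp add: scalar_mult_eq_scaleR)
  ultimately show "integrable M X" by simp
qed

context prob_space
begin

lemma sigma_finite_subalgebra_subalgebra: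
  "subalgebra M F \<Longrightarrow> sigma_finite_subalgebra M F"
  by (intro finite_measure_subalgebra_is_sigma_finite)
    (simp add: finite_measure_subalgebra_def finite_measure_subalgebra_axioms_def finite_measure_axioms)

lemma integrable_vec_cond_exp:
  assumes "subalgebra M F" "integrable M X"
  shows "integrable M (vec_cond_exp M F X)"
proof -
  interpret sigma_finite_subalgebra M F by (rule sigma_finite_subalgebra_subalgebra[OF assms(1)])
  show ?thesis
    unfolding integrable_vec_iff using assms(2)
    by (auto simp: vec_cond_exp_def integrable_vec_iff intro!: real_cond_exp_int(1))
qed

text \<open>The defining property of real conditional expectation, summed over coordinates. It shows
  that tests measurable for \<open>F\<close> cannot tell \<open>X\<close> from its conditional
  expectation.\<close>

lemma integral_vec_cond_exp_inner:
  fixes X Y :: "'a \<Rightarrow> real ^ 'n"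
  assumes F: "subalgebra M F" and X: "integrable M X"
    and Y: "Y \<in> borel_measurable F" "AE \<omega> in M. norm (Y \<omega>) \<le> K"
  shows "(\<integral>\<omega>. vec_cond_exp M F X \<omega> \<bullet> Y \<omega> \<partial>M) = (\<integral>\<omega>. X \<omega> \<bullet> Y \<omega> \<partial>M)"
proof -
  interpret sigma_finite_subalgebra M F by (rule sigma_finite_subalgebra_subalgebra[OF F])
  have Yi: "(\<lambda>\<omega>. Y \<omega> $ i) \<in> borel_measurable F" for i
    using Y(1) by (simp add: borel_measurable_vec_iff)
  have Xi: "integrable M (\<lambda>\<omega>. X \<omega> $ i)" for i using X by (simp add: integrable_vec_iff)
  have YX: "integrable M (\<lambda>\<omega>. Y \<omega> $ i * X \<omega> $ i)" for i
  proof -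
    have "integrable M (\<lambda>\<omega>. X \<omega> $ i \<bullet> Y \<omega> $ i)"
    proof (rule integrable_inner_AE_bounded[OF Xi measurable_from_subalg[OF F Yi]])
      show "AE \<omega> in M. norm (Y \<omega> $ i) \<le> K"
        using Y(2) by eventually_elim (meson Finite_Cartesian_Product.norm_nth_le order_trans)
    qed
    then show ?thesis by (simp add: mult.commute)
  qed
  have i: "integrable M (\<lambda>\<omega>. Y \<omega> $ i * real_cond_exp M F (\<lambda>\<omega>. X \<omega> $ i) \<omega>)"
    "(\<integral>\<omega>. Y \<omega> $ i * real_cond_exp M F (\<lambda>\<omega>. X \<omega> $ i) \<omega> \<partial>M) = (\<integral>\<omega>. Y \<omega> $ i * X \<omega> $ i \<partial>M)" for i
    using real_cond_exp_intg[OF YX Yi] Xi by auto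
  show ?thesis
    using i YX by (simp add: inner_vec_def vec_cond_exp_def mult.commute)
qed

text \<open>
  \<open>E[X' | F]\<close> and \<open>E[X | F]\<close> differ by at most \<open>B\<close>; hence \<open>h\<close> is within \<open>\<epsilon>' + B\<close> of \<open>E[X | F]\<close>,
  which is within \<open>\<epsilon>\<close> of \<open>E[X | F']\<close>.
\<close>

lemma cond_norm_le_approx:
  fixes X X' h :: "'a \<Rightarrow> real ^ 'n"
  assumes F': "subalgebra M F'" and FF': "subalgebra F' F"
    and X: "integrable M X" and X': "integrable M X'" and h: "integrable M h"
    and approx: "AE \<omega> in M. norm (h \<omega> - vec_cond_exp M F X' \<omega>) \<le> \<epsilon>'"
    and add_info: "AE \<omega> in M. norm (vec_cond_exp M F X \<omega> - vec_cond_exp M F' X \<omega>) \<le> \<epsilon>"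
    and b: "cond_norm_le M F (\<lambda>\<omega>. X' \<omega> - X \<omega>) B"
  shows "cond_norm_le M F' (\<lambda>\<omega>. h \<omega> - X \<omega>) (\<epsilon> + \<epsilon>' + B)"
proof -
  let ?V = "vec_cond_exp M F X" and ?V' = "vec_cond_exp M F X'" and ?Z = "vec_cond_exp M F' X"
  have F: "subalgebra M F" using F' FF' by (auto simp: subalgebra_def)
  note i = integrable_vec_cond_exp[OF F X] integrable_vec_cond_exp[OF F X']
    integrable_vec_cond_exp[OF F' X]
  have "cond_norm_le M F (\<lambda>\<omega>. ?V' \<omega> - ?V \<omega>) B"
  proof (rule cond_norm_leI)
    fix Y :: "'a \<Rightarrow> real ^ 'n" and K
    assume Y: "Y \<in> borel_measurable F" "AE \<omega> in M. norm (Y \<omega>) \<le> K"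
    note j = integrable_inner_AE_bounded[OF _ measurable_from_subalg[OF F Y(1)] Y(2)]
    have "(\<integral>\<omega>. (?V' \<omega> - ?V \<omega>) \<bullet> Y \<omega> \<partial>M) = (\<integral>\<omega>. (X' \<omega> - X \<omega>) \<bullet> Y \<omega> \<partial>M)"
      using j[OF i(1)] j[OF i(2)] j[OF X] j[OF X']
      by (simp add: inner_diff_left integral_vec_cond_exp_inner[OF F _ Y] X X')
    then show "(\<integral>\<omega>. (?V' \<omega> - ?V \<omega>) \<bullet> Y \<omega> \<partial>M) \<le> B * (\<integral>\<omega>. norm (Y \<omega>) \<partial>M)"
      using cond_norm_leD[OF b Y] by simp
  qed
  \<comment> \<open>Both conditional expectations are measurable for \<open>F\<close>, so the weak
    bound on their difference becomes pointwise and can enter the triangle inequality below.\<close>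
  then have "AE \<omega> in M. norm (?V' \<omega> - ?V \<omega>) \<le> B"
    using i by (intro AE_bounded_cond_norm_le[OF _ F])
      (auto intro!: borel_measurable_diff vec_cond_exp_measurable)
  with approx add_info have "AE \<omega> in M. norm (h \<omega> - ?Z \<omega>) \<le> \<epsilon> + \<epsilon>' + B"
  proof eventually_elim
    case (elim \<omega>)
    have "h \<omega> - ?Z \<omega> = (h \<omega> - ?V' \<omega>) + (?V' \<omega> - ?V \<omega>) + (?V \<omega> - ?Z \<omega>)" by simp
    then have "norm (h \<omega> - ?Z \<omega>)
        \<le> norm (h \<omega> - ?V' \<omega>) + norm (?V' \<omega> - ?V \<omega>) + norm (?V \<omega> - ?Z \<omega>)"
      by (metis norm_triangle_ineq norm_add_rule_thm order_refl)
    then show ?case using elim by simp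
  qed
  then have *: "cond_norm_le M F' (\<lambda>\<omega>. h \<omega> - ?Z \<omega>) (\<epsilon> + \<epsilon>' + B)"
    using h i by (intro cond_norm_le_AE_bounded[OF _ F']) auto
  \<comment> \<open>Against tests measurable for \<open>F'\<close>, \<open>X\<close> and
    \<open>?Z\<close> have the same integrals, so the bound on \<open>h - ?Z\<close> passes to
    \<open>h - X\<close>.\<close>
  show ?thesis
  proof (rule cond_norm_leI)
    fix Y :: "'a \<Rightarrow> real ^ 'n" and K
    assume Y: "Y \<in> borel_measurable F'" "AE \<omega> in M. norm (Y \<omega>) \<le> K"
    note j = integrable_inner_AE_bounded[OF _ measurable_from_subalg[OF F' Y(1)] Y(2)]
    have "(\<integral>\<omega>. (h \<omega> - X \<omega>) \<bullet> Y \<omega> \<partial>M) = (\<integral>\<omega>. (h \<omega> - ?Z \<omega>) \<bullet> Y \<omega> \<partial>M)"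
      using j[OF h] j[OF X] j[OF i(3)]
      by (simp add: inner_diff_left integral_vec_cond_exp_inner[OF F' X Y])
    then show "(\<integral>\<omega>. (h \<omega> - X \<omega>) \<bullet> Y \<omega> \<partial>M) \<le> (\<epsilon> + \<epsilon>' + B) * (\<integral>\<omega>. norm (Y \<omega>) \<partial>M)"
      using cond_norm_leD[OF * Y] by simp
  qed
qed

end

section \<open>Empirical means and the mean squared error\<close>

lemma integrable_inner_square_integrable:
  fixes X Y :: "'w \<Rightarrow> real ^ 'n"
  assumes "square_integrable M X" "square_integrable M Y"
  shows "integrable M (\<lambda>\<omega>. X \<omega> \<bullet> Y \<omega>)"
proof -
  have [measurable]: "X \<in> borel_measurable M" "Y \<in> borel_measurable M"
    using assms by (auto simp: square_integrable_def)
  show ?thesis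
  proof (rule Bochner_Integration.integrable_bound)
    show "integrable M (\<lambda>\<omega>. (norm (X \<omega>))\<^sup>2 + (norm (Y \<omega>))\<^sup>2)"
      using assms by (simp add: square_integrable_def)
    have "\<bar>a \<bullet> b\<bar> \<le> (norm a)\<^sup>2 + (norm b)\<^sup>2" for a b :: "real ^ 'n"
    proof -
      have "\<bar>a \<bullet> b\<bar> \<le> norm a * norm b" by (rule Cauchy_Schwarz_ineq2)
      moreover have "0 \<le> norm a * norm b" by simp
      ultimately show ?thesis
        using zero_le_power2[of "norm a - norm b"] by (simp add: power2_eq_square algebra_simps)
    qed
    then show "AE \<omega> in M. norm (X \<omega> \<bullet> Y \<omega>) \<le> norm ((norm (X \<omega>))\<^sup>2 + (norm (Y \<omega>))\<^sup>2)" by simp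
  qed measurable
qed

lemma (in finite_measure) square_integrable_const: "square_integrable M (\<lambda>_. a)"
  by (simp add: square_integrable_def)

lemma iid_draws_measurable:
  assumes "iid_draws N M n W" "i < n"
  shows "W i \<in> measurable N M"
  using assms prob_space.indep_vars_def[of N "\<lambda>_. M" W] by (simp add: iid_draws_def)

lemma iid_draws_integral:
  fixes X :: "'w \<Rightarrow> 'b::euclidean_space"
  assumes "iid_draws N M n W" "i < n" "X \<in> borel_measurable M"
  shows "(\<integral>\<sigma>. X (W i \<sigma>) \<partial>N) = (\<integral>\<omega>. X \<omega> \<partial>M)"
    and "integrable N (\<lambda>\<sigma>. X (W i \<sigma>)) \<longleftrightarrow> integrable M X"
proof -
  have D: "distr N M (W i) = M" using assms(1,2) by (simp add: iid_draws_def)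
  note W = iid_draws_measurable[OF assms(1,2)]
  show "(\<integral>\<sigma>. X (W i \<sigma>) \<partial>N) = (\<integral>\<omega>. X \<omega> \<partial>M)"
    using integral_distr[OF W assms(3)] unfolding D by (rule sym)
  show "integrable N (\<lambda>\<sigma>. X (W i \<sigma>)) \<longleftrightarrow> integrable M X"
    using integrable_distr_eq[OF W assms(3)] unfolding D by (rule sym)
qed

lemma iid_draws_square_integrable:
  fixes X :: "'w \<Rightarrow> real ^ 'n"
  assumes "iid_draws N M n W" "i < n" "square_integrable M X"
  shows "square_integrable N (\<lambda>\<sigma>. X (W i \<sigma>))"
proof -
  have [measurable]: "X \<in> borel_measurable M" using assms(3) by (simp add: square_integrable_def)
  show ?thesis
    using iid_draws_integral(2)[OF assms(1,2), of "\<lambda>\<omega>. (norm (X \<omega>))\<^sup>2"] assms(3)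
      measurable_compose[OF iid_draws_measurable[OF assms(1,2)], of X borel]
    by (simp add: square_integrable_def)
qed

lemma square_integrable_empirical_mean:
  fixes X :: "'w \<Rightarrow> real ^ 'n"
  assumes "iid_draws N M n W" "square_integrable M X"
  shows "square_integrable N (empirical_mean n W X)"
  unfolding empirical_mean_def
  using assms(2) by (intro square_integrable_scaleR square_integrable_sum
      iid_draws_square_integrable[OF assms(1)]) auto

text \<open>Independence factors each coordinate product. Applied to a centred vector, this removes
  the off-diagonal terms in the variance of an empirical mean.\<close>

lemma iid_draws_inner:
  fixes X :: "'w \<Rightarrow> real ^ 'n"
  assumes iid: "iid_draws N M n W" and "i < n" "j < n" "i \<noteq> j" and X: "integrable M X"
  shows "(\<integral>\<sigma>. X (W i \<sigma>) \<bullet> X (W j \<sigma>) \<partial>N) = (\<integral>\<omega>. X \<omega> \<partial>M) \<bullet> (\<integral>\<omega>. X \<omega> \<partial>M)"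
proof -
  interpret N: prob_space N using iid by (simp add: iid_draws_def)
  have [measurable]: "X \<in> borel_measurable M" using X by simp
  have Xk: "integrable M (\<lambda>\<omega>. X \<omega> $ k)" for k using X by (simp add: integrable_vec_iff)
  have int: "integrable N (\<lambda>\<sigma>. X (W l \<sigma>) $ k)" if "l < n" for l k
    using iid_draws_integral(2)[OF iid that, of "\<lambda>\<omega>. X \<omega> $ k"] Xk[of k] by simp
  have ex: "(\<integral>\<sigma>. X (W l \<sigma>) $ k \<partial>N) = (\<integral>\<omega>. X \<omega> \<partial>M) $ k" if "l < n" for l k
  proof -
    have "(\<integral>\<sigma>. X (W l \<sigma>) $ k \<partial>N) = (\<integral>\<omega>. X \<omega> $ k \<partial>M)"
      using iid_draws_integral(1)[OF iid that, of "\<lambda>\<omega>. X \<omega> $ k"] Xk[of k] by simp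
    also have "\<dots> = (\<integral>\<omega>. X \<omega> \<partial>M) $ k"
      using integral_inner_left[of "axis k 1" M X] X by (simp add: inner_axis)
    finally show ?thesis .
  qed
  have "N.indep_vars (\<lambda>_. borel) (\<lambda>l \<sigma>. X (W l \<sigma>) $ k) {i, j}" for k
  proof (rule N.indep_vars_compose2[where Y = "\<lambda>_ \<omega>. X \<omega> $ k"])
    show "N.indep_vars (\<lambda>_. M) W {i, j}"
      using iid assms(2,3) by (auto simp: iid_draws_def intro: N.indep_vars_subset)
    show "(\<lambda>\<omega>. X \<omega> $ k) \<in> borel_measurable M" using Xk[of k] by simp
  qed
  note indep = this
  have "integrable N (\<lambda>\<sigma>. X (W i \<sigma>) $ k * X (W j \<sigma>) $ k)"
    and "(\<integral>\<sigma>. X (W i \<sigma>) $ k * X (W j \<sigma>) $ k \<partial>N) = (\<integral>\<omega>. X \<omega> \<partial>M) $ k * (\<integral>\<omega>. X \<omega> \<partial>M) $ k" for k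
    using N.indep_vars_integrable[OF _ indep[of k]] N.indep_vars_lebesgue_integral[OF _ indep[of k]]
      int ex assms(2-4) by auto
  then show ?thesis by (simp add: inner_vec_def)
qed

text \<open>Bias-variance decomposition: the centred sum \<open>S\<close> has mean zero, and its
  second moment consists of \<open>n\<close> diagonal terms, because the cross terms vanish.\<close>

lemma bias_variance_empirical_mean:
  fixes X :: "'w \<Rightarrow> real ^ 'n"
  assumes M: "prob_space M" and iid: "iid_draws N M n W" and n: "n \<ge> 1" and X: "square_integrable M X"
  shows "(\<integral>\<sigma>. (norm (empirical_mean n W X \<sigma> - m))\<^sup>2 \<partial>N)
    = tr_cov M X / real n + (norm ((\<integral>\<omega>. X \<omega> \<partial>M) - m))\<^sup>2"
proof -
  interpret M: prob_space M by (rule M)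
  interpret N: prob_space N using iid by (simp add: iid_draws_def)
  define \<mu> where "\<mu> = (\<integral>\<omega>. X \<omega> \<partial>M)"
  define Z where "Z \<omega> = X \<omega> - \<mu>" for \<omega>
  have Z: "square_integrable M Z"
    using square_integrable_add[OF X M.square_integrable_const[of "- \<mu>"]] by (simp add: Z_def[abs_def])
  have Zint: "integrable M Z" by (rule M.integrable_if_square_integrable[OF Z])
  have Z0: "(\<integral>\<omega>. Z \<omega> \<partial>M) = 0"
    using M.integrable_if_square_integrable[OF X] by (simp add: Z_def[abs_def] \<mu>_def M.prob_space)
  define S where "S \<sigma> = (\<Sum>i<n. Z (W i \<sigma>))" for \<sigma>
  have ZW: "square_integrable N (\<lambda>\<sigma>. Z (W i \<sigma>))" if "i < n" for i
    by (rule iid_draws_square_integrable[OF iid that Z])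
  have S: "square_integrable N S"
    unfolding S_def[abs_def] using ZW by (intro square_integrable_sum) auto
  have S0: "(\<integral>\<sigma>. S \<sigma> \<partial>N) = 0"
    unfolding S_def
    using ZW N.integrable_if_square_integrable iid_draws_integral(1)[OF iid, of _ Z] Zint Z0
    by (subst Bochner_Integration.integral_sum) auto
  have cross: "(\<integral>\<sigma>. Z (W i \<sigma>) \<bullet> Z (W j \<sigma>) \<partial>N) = (if i = j then tr_cov M X else 0)"
    if "i < n" "j < n" for i j
  proof (cases "i = j")
    case True
    have "(\<integral>\<sigma>. Z (W i \<sigma>) \<bullet> Z (W i \<sigma>) \<partial>N) = (\<integral>\<omega>. Z \<omega> \<bullet> Z \<omega> \<partial>M)"
      using Zint by (intro iid_draws_integral(1)[OF iid that(1), of "\<lambda>\<omega>. Z \<omega> \<bullet> Z \<omega>"]) auto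
    then show ?thesis
      using True by (simp add: tr_cov_def Z_def \<mu>_def dot_square_norm)
  next
    case False
    then show ?thesis using iid_draws_inner[OF iid that False Zint] Z0 by simp
  qed
  have "(\<integral>\<sigma>. S \<sigma> \<bullet> S \<sigma> \<partial>N) = (\<Sum>i<n. \<Sum>j<n. \<integral>\<sigma>. Z (W i \<sigma>) \<bullet> Z (W j \<sigma>) \<partial>N)"
  proof -
    have "(\<integral>\<sigma>. S \<sigma> \<bullet> S \<sigma> \<partial>N) = (\<integral>\<sigma>. (\<Sum>i<n. \<Sum>j<n. Z (W i \<sigma>) \<bullet> Z (W j \<sigma>)) \<partial>N)"
      by (simp add: S_def inner_sum_left inner_sum_right inner_commute)
    also have "\<dots> = (\<Sum>i<n. \<integral>\<sigma>. (\<Sum>j<n. Z (W i \<sigma>) \<bullet> Z (W j \<sigma>)) \<partial>N)"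
      using integrable_inner_square_integrable[OF ZW ZW]
      by (intro Bochner_Integration.integral_sum Bochner_Integration.integrable_sum) auto
    also have "\<dots> = (\<Sum>i<n. \<Sum>j<n. \<integral>\<sigma>. Z (W i \<sigma>) \<bullet> Z (W j \<sigma>) \<partial>N)"
      using integrable_inner_square_integrable[OF ZW ZW]
      by (intro sum.cong refl Bochner_Integration.integral_sum) auto
    finally show ?thesis .
  qed
  also have "\<dots> = (\<Sum>i<n. \<Sum>j<n. if i = j then tr_cov M X else 0)"
    using cross by (intro sum.cong refl) auto
  also have "\<dots> = real n * tr_cov M X" by (simp add: sum.delta)
  finally have SS: "(\<integral>\<sigma>. S \<sigma> \<bullet> S \<sigma> \<partial>N) = real n * tr_cov M X" .
  \<comment> \<open>Here \<open>n \<ge> 1\<close> is essential: the \<open>n\<close> copies of the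
    mean cancel against the factor \<open>1 / real n\<close>.\<close>
  have em: "empirical_mean n W X \<sigma> - m = (1 / real n) *\<^sub>R S \<sigma> + (\<mu> - m)" for \<sigma>
    using n
    by (simp add: empirical_mean_def S_def Z_def sum_subtractf scaleR_diff_right sum_constant_scaleR
        del: sum_constant)
  have "(\<integral>\<sigma>. (norm (empirical_mean n W X \<sigma> - m))\<^sup>2 \<partial>N)
    = (\<integral>\<sigma>. (1 / real n)\<^sup>2 * (S \<sigma> \<bullet> S \<sigma>) + (2 / real n) * (S \<sigma> \<bullet> (\<mu> - m)) + (norm (\<mu> - m))\<^sup>2 \<partial>N)"
  proof (intro Bochner_Integration.integral_cong refl)
    fix \<sigma>
    have "(norm (a *\<^sub>R y + b))\<^sup>2 = a\<^sup>2 * (y \<bullet> y) + (2 * a) * (y \<bullet> b) + (norm b)\<^sup>2" for a and y b :: "real ^ 'n"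
      by (simp add: power2_norm_eq_inner inner_add_left inner_add_right inner_commute[of b y]
          power2_eq_square[of a] algebra_simps)
    from this[of "1 / real n" "S \<sigma>" "\<mu> - m"]
    show "(norm (empirical_mean n W X \<sigma> - m))\<^sup>2
      = (1 / real n)\<^sup>2 * (S \<sigma> \<bullet> S \<sigma>) + (2 / real n) * (S \<sigma> \<bullet> (\<mu> - m)) + (norm (\<mu> - m))\<^sup>2"
      unfolding em by simp
  qed
  also have "\<dots> = (1 / real n)\<^sup>2 * (\<integral>\<sigma>. S \<sigma> \<bullet> S \<sigma> \<partial>N) + (2 / real n) * ((\<integral>\<sigma>. S \<sigma> \<partial>N) \<bullet> (\<mu> - m))
    + (norm (\<mu> - m))\<^sup>2"
    using integrable_inner_square_integrable[OF S S] N.integrable_if_square_integrable[OF S]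
    by (simp add: N.prob_space)
  also have "\<dots> = tr_cov M X / real n + (norm (\<mu> - m))\<^sup>2"
    unfolding SS S0 using n by (simp add: power2_eq_square)
  finally show ?thesis by (simp add: \<mu>_def)
qed

text \<open>The error is a quadratic polynomial in the weight. Continuity is what guarantees that a
  minimiser on the unit interval exists.\<close>

lemma continuous_mixing_mse:
  fixes p s :: "'w \<Rightarrow> real ^ 'n"
  assumes iid: "iid_draws N M n W" and p: "square_integrable M p" and s: "square_integrable M s"
  shows "continuous_on A (mixing_mse N n W p s m)"
proof -
  interpret N: prob_space N using iid by (simp add: iid_draws_def)
  \<comment> \<open>The mixed estimator moves along a line in the weight: \<open>Q\<close> is its
    error at weight 0 and \<open>D\<close> the direction of motion.\<close>
  define Q where "Q \<sigma> = empirical_mean n W s \<sigma> + - m" for \<sigma>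
  define D where "D \<sigma> = empirical_mean n W p \<sigma> + (- 1) *\<^sub>R empirical_mean n W s \<sigma>" for \<sigma>
  have Q: "square_integrable N Q" and D: "square_integrable N D"
    unfolding Q_def[abs_def] D_def[abs_def]
    by (intro square_integrable_add square_integrable_scaleR N.square_integrable_const
        square_integrable_empirical_mean[OF iid] p s)+
  have "mixing_mse N n W p s m l
    = (\<integral>\<sigma>. Q \<sigma> \<bullet> Q \<sigma> \<partial>N) + 2 * l * (\<integral>\<sigma>. Q \<sigma> \<bullet> D \<sigma> \<partial>N) + l\<^sup>2 * (\<integral>\<sigma>. D \<sigma> \<bullet> D \<sigma> \<partial>N)" for l
  proof -
    have e: "l *\<^sub>R empirical_mean n W p \<sigma> + (1 - l) *\<^sub>R empirical_mean n W s \<sigma> - m = Q \<sigma> + l *\<^sub>R D \<sigma>" for \<sigma>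
      by (simp add: Q_def D_def algebra_simps)
    have "mixing_mse N n W p s m l
      = (\<integral>\<sigma>. Q \<sigma> \<bullet> Q \<sigma> + 2 * l * (Q \<sigma> \<bullet> D \<sigma>) + l\<^sup>2 * (D \<sigma> \<bullet> D \<sigma>) \<partial>N)"
      unfolding mixing_mse_def e
      by (intro Bochner_Integration.integral_cong refl)
        (simp add: power2_norm_eq_inner inner_add_left inner_add_right inner_commute
          power2_eq_square[of l] algebra_simps)
    then show ?thesis
      using integrable_inner_square_integrable[OF Q Q] integrable_inner_square_integrable[OF Q D]
        integrable_inner_square_integrable[OF D D] by simp
  qed
  then have "mixing_mse N n W p s m = (\<lambda>l. (\<integral>\<sigma>. Q \<sigma> \<bullet> Q \<sigma> \<partial>N) + 2 * l * (\<integral>\<sigma>. Q \<sigma> \<bullet> D \<sigma> \<partial>N)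
      + l\<^sup>2 * (\<integral>\<sigma>. D \<sigma> \<bullet> D \<sigma> \<partial>N))" by (rule ext)
  then show ?thesis by (auto intro!: continuous_intros)
qed

text \<open>\<open>arg_min_on\<close> is a choice operator and means a minimiser only once one
  exists; compactness supplies it.\<close>

lemma arg_min_on_continuous_compact:
  fixes F :: "'a::topological_space \<Rightarrow> real"
  assumes "compact S" "S \<noteq> {}" "continuous_on S F"
  shows "arg_min_on F S \<in> S" "\<And>y. y \<in> S \<Longrightarrow> F (arg_min_on F S) \<le> F y"
proof -
  obtain a where "a \<in> S" "\<forall>y\<in>S. F a \<le> F y" using continuous_attains_inf[OF assms] by blast
  then have "is_arg_min F (\<lambda>a. a \<in> S) a" by (auto simp: is_arg_min_linorder)
  then have "is_arg_min F (\<lambda>a. a \<in> S) (arg_min_on F S)"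
    unfolding arg_min_on_def arg_min_def by (rule someI)
  then show "arg_min_on F S \<in> S" "\<And>y. y \<in> S \<Longrightarrow> F (arg_min_on F S) \<le> F y"
    by (auto simp: is_arg_min_linorder)
qed

text \<open>
  The bias of \<open>p\<close> only increases the error at \<open>l = 1\<close>, so the variance gap has to beat the bias of
  \<open>s\<close> alone; neither convexity of the error nor uniqueness of its minimiser plays a role.
\<close>

lemma optimal_weight_less_1:
  fixes p s :: "'w \<Rightarrow> real ^ 'n"
  assumes M: "prob_space M" and iid: "iid_draws N M n W" and n: "n \<ge> 1"
    and p: "square_integrable M p" and s: "square_integrable M s"
    and gap: "(tr_cov M p - tr_cov M s) / real n > (norm ((\<integral>\<omega>. s \<omega> \<partial>M) - m))\<^sup>2"
  shows "optimal_weight M N n W p s m < 1"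
proof -
  let ?F = "mixing_mse N n W p s m" and ?a = "arg_min_on (mixing_mse N n W p s m) {0..1::real}"
  have F0: "?F 0 = tr_cov M s / real n + (norm ((\<integral>\<omega>. s \<omega> \<partial>M) - m))\<^sup>2"
    and F1: "?F 1 = tr_cov M p / real n + (norm ((\<integral>\<omega>. p \<omega> \<partial>M) - m))\<^sup>2"
    using bias_variance_empirical_mean[OF M iid n s, of m] bias_variance_empirical_mean[OF M iid n p, of m]
    by (simp_all add: mixing_mse_def)
  have "?F 0 < tr_cov M p / real n" using gap by (simp add: F0 diff_divide_distrib)
  also have "\<dots> \<le> ?F 1" by (simp add: F1)
  finally have less: "?F 0 < ?F 1" .
  have "?a \<in> {0..1}" "?F ?a \<le> ?F 0"
    using arg_min_on_continuous_compact[of "{0..1::real}" ?F] continuous_mixing_mse[OF iid p s] by auto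
  then have "?a < 1" using less by (cases "?a = 1") auto
  \<comment> \<open>In the degenerate case \<open>p = s\<close> almost surely, the conventional
    value 0 is below 1 as well.\<close>
  then show ?thesis by (simp add: optimal_weight_def)
qed

section \<open>Extended ancestors and observations\<close>

context layered_graph
begin

lemma self_in_an_sib: "layer u \<noteq> 0 \<Longrightarrow> u \<in> an_sib E layer u"
  by (cases "layer u") (auto simp: an_sib_def sib_def)

text \<open>The recursion collects siblings, which share a layer, and contributes nothing at layer
  0. Hence all observations conditioned on belong to non-input nodes, where \<open>z\<close> is
  known to be measurable.\<close>

lemma layer_an_sib_at: "layer u = l \<Longrightarrow> w \<in> an_sib_at E layer l u \<Longrightarrow> layer w \<noteq> 0"
proof (induction l arbitrary: u)
  case 0
  then show ?case by simp
next
  case (Suc l)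
  from Suc.prems(2) consider (an) u' v' where "v' \<in> sib E layer u" "u' \<in> pa E v'"
      "w \<in> an_sib_at E layer l u'" | (sib) "w \<in> sib E layer u" by auto
  then show ?case
  proof cases
    case an
    then have "layer u' = l"
      using edge_layer[of u' v'] Suc.prems(1) by (auto simp: sib_def pa_def)
    then show ?thesis using Suc.IH an by blast
  next
    case sib
    then show ?thesis using Suc.prems(1) by (auto simp: sib_def)
  qed
qed

lemma layer_an_sib: "w \<in> an_sib E layer u \<Longrightarrow> layer w \<noteq> 0"
  unfolding an_sib_def by (rule layer_an_sib_at[OF refl])

text \<open>\<open>w\<close> is its own sibling, so its parent \<open>u\<close> occurs in the
  recursion at \<open>w\<close>. Observations gathered at \<open>u\<close> thereby stay admissible
  in (B') at \<open>w\<close>.\<close>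

lemma an_sib_parent:
  assumes "(u, w) \<in> E"
  shows "an_sib E layer u \<subseteq> an_sib E layer w"
proof -
  have "u \<in> (\<Union>v'\<in>sib E layer w. pa E v')" using assms by (auto simp: sib_def pa_def)
  then have "an_sib_at E layer (layer u) u \<subseteq> an_sib_at E layer (Suc (layer u)) w"
    unfolding an_sib_at.simps by blast
  then show ?thesis by (simp only: an_sib_def edge_layer[OF assms])
qed

end

context layered_model
begin

lemma z_measurable:
  assumes w: "layer w \<noteq> 0"
  shows "z w \<in> measurable M (borel \<Otimes>\<^sub>M \<Xi> w)"
proof -
  have [measurable]: "x u \<in> borel_measurable M" for u
    using x_square_integrable by (simp add: square_integrable_def)
  have x: "(\<lambda>\<omega>. \<chi> u. if u \<in> pa E w then x u \<omega> else 0) \<in> borel_measurable M"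
  proof -
    have "(\<lambda>\<omega>. (if u \<in> pa E w then x u \<omega> else 0) $ i) \<in> borel_measurable M" for u i
      using borel_measurable_vec_iff[of "x u" M] by (cases "u \<in> pa E w") auto
    then show ?thesis
      by (subst borel_measurable_euclidean_space) (auto simp: Basis_vec_def inner_axis)
  qed
  have "(\<lambda>\<omega>. (\<chi> u. if u \<in> pa E w then x u \<omega> else 0, \<xi> w \<omega>)) \<in> measurable M (borel \<Otimes>\<^sub>M \<Xi> w)"
    using x \<xi>_measurable[OF w] by (rule measurable_Pair)
  then show ?thesis using z_eq[OF w] by (subst measurable_cong[of M]) auto
qed

lemma sets_obs_algebra:
  "sets (obs_algebra M \<Xi> z S) = sigma_sets (space M)
    (\<Union>w\<in>S. sets (vimage_algebra (space M) (z w) (borel \<Otimes>\<^sub>M \<Xi> w)))"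
proof -
  have "sets (vimage_algebra (space M) (z w) (borel \<Otimes>\<^sub>M \<Xi> w)) \<subseteq> Pow (space M)" for w
    using sets.space_closed[of "vimage_algebra (space M) (z w) (borel \<Otimes>\<^sub>M \<Xi> w)"] by simp
  then show ?thesis unfolding obs_algebra_def by (intro sets_measure_of UN_least)
qed

lemma space_obs_algebra: "space (obs_algebra M \<Xi> z S) = space M"
  unfolding obs_algebra_def by (simp add: space_measure_of_conv)

lemma obs_algebra_subalgebra:
  assumes "\<And>w. w \<in> S \<Longrightarrow> layer w \<noteq> 0"
  shows "subalgebra M (obs_algebra M \<Xi> z S)"
proof -
  have "sets (vimage_algebra (space M) (z w) (borel \<Otimes>\<^sub>M \<Xi> w)) \<subseteq> sets M" if "w \<in> S" for w
    using z_measurable[OF assms[OF that]] by (intro sets_image_in_sets) auto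
  then show ?thesis
    unfolding subalgebra_def sets_obs_algebra space_obs_algebra
    by (auto intro!: sets.sigma_sets_subset)
qed

lemma obs_algebra_mono:
  "S \<subseteq> T \<Longrightarrow> subalgebra (obs_algebra M \<Xi> z T) (obs_algebra M \<Xi> z S)"
  unfolding subalgebra_def sets_obs_algebra space_obs_algebra
  by (intro conjI refl sigma_sets_mono' UN_mono order_refl)

lemma z_measurable_obs_algebra:
  assumes w: "w \<in> S" "layer w \<noteq> 0"
  shows "z w \<in> measurable (obs_algebra M \<Xi> z S) (borel \<Otimes>\<^sub>M \<Xi> w)"
proof (rule measurableI)
  fix \<omega> assume "\<omega> \<in> space (obs_algebra M \<Xi> z S)"
  then show "z w \<omega> \<in> space (borel \<Otimes>\<^sub>M \<Xi> w)"
    using z_measurable[OF w(2)] by (auto simp: space_obs_algebra dest: measurable_space)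
next
  fix A :: "(((real ^ 'c) ^ 'v) \<times> 'e) set" assume "A \<in> sets (borel \<Otimes>\<^sub>M \<Xi> w)"
  then have "z w -` A \<inter> space M \<in> sets (vimage_algebra (space M) (z w) (borel \<Otimes>\<^sub>M \<Xi> w))"
    by (rule in_vimage_algebra)
  then show "z w -` A \<inter> space (obs_algebra M \<Xi> z S) \<in> sets (obs_algebra M \<Xi> z S)"
    unfolding sets_obs_algebra space_obs_algebra using w(1) by (intro sigma_sets.Basic) auto
qed

end

section \<open>Measurability of Jacobians\<close>

text \<open>Differentiability alone gives no continuity of the Jacobian; its measurability comes
  from writing each entry as a sequential limit of difference quotients.\<close>

lemma directional_derivative_LIMSEQ:
  fixes \<phi> :: "'a::euclidean_space \<Rightarrow> real ^ 'n"
  assumes "\<phi> differentiable (at a)"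
  shows "(\<lambda>k. (\<phi> (a + inverse (real (Suc k)) *\<^sub>R d) $ i - \<phi> a $ i) / inverse (real (Suc k)))
    \<longlonglongrightarrow> frechet_derivative \<phi> (at a) d $ i"
proof -
  let ?D = "frechet_derivative \<phi> (at a)"
  have "(\<phi> has_derivative ?D) (at a)"
    using assms frechet_derivative_works by blast
  then have D: "(\<phi> has_derivative ?D) (at (a + 0 *\<^sub>R d))" by simp
  have "((\<lambda>t. a + t *\<^sub>R d) has_derivative (\<lambda>t. t *\<^sub>R d)) (at 0)"
    by (auto intro!: derivative_eq_intros)
  from has_derivative_compose[OF this D]
  have "((\<lambda>t. \<phi> (a + t *\<^sub>R d) $ i) has_derivative (\<lambda>t. ?D (t *\<^sub>R d) $ i)) (at 0)"
    by (rule bounded_linear.has_derivative[OF bounded_linear_vec_nth])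
  moreover have "?D (t *\<^sub>R d) $ i = ?D d $ i * t" for t
    using linear_scale[OF linear_frechet_derivative[OF assms]] by simp
  ultimately have "((\<lambda>t. \<phi> (a + t *\<^sub>R d) $ i) has_real_derivative ?D d $ i) (at 0)"
    by (simp add: has_field_derivative_def)
  then have "((\<lambda>t. (\<phi> (a + t *\<^sub>R d) $ i - \<phi> a $ i) / t) \<longlongrightarrow> ?D d $ i) (at 0)"
    by (simp add: DERIV_def)
  \<comment> \<open>The limit at 0 excludes 0 itself; the steps \<open>1 / Suc k\<close> tend to 0
    without reaching it.\<close>
  moreover have "filterlim (\<lambda>k. inverse (real (Suc k))) (at 0) sequentially"
    using LIMSEQ_inverse_real_of_nat by (simp add: filterlim_at)
  ultimately show ?thesis by (rule filterlim_compose)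
qed

context layered_model
begin

lemma param_jac_measurable:
  assumes w: "layer w \<noteq> 0"
  shows "(\<lambda>a. param_jac f \<theta> w a $ j $ i) \<in> borel_measurable (borel \<Otimes>\<^sub>M \<Xi> w)"
proof (rule borel_measurable_LIMSEQ_metric)
  let ?q = "\<lambda>k a. (f w a (\<theta> w + inverse (real (Suc k)) *\<^sub>R axis j 1) $ i - f w a (\<theta> w) $ i)
    / inverse (real (Suc k))"
  have [measurable]: "(\<lambda>a. f w a t $ i) \<in> borel_measurable (borel \<Otimes>\<^sub>M \<Xi> w)" for t
    using f_measurable[OF w, of t] by (simp add: borel_measurable_vec_iff)
  show "?q k \<in> borel_measurable (borel \<Otimes>\<^sub>M \<Xi> w)" for k by measurable
  fix a :: "((real ^ 'c) ^ 'v) \<times> 'e" assume "a \<in> space (borel \<Otimes>\<^sub>M \<Xi> w)"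
  then have e: "snd a \<in> space (\<Xi> w)" by (auto simp: space_pair_measure)
  \<comment> \<open>Joint differentiability in values and parameter restricts to the parameter along
    an affine embedding.\<close>
  have "((\<lambda>(y, t). f w (y, snd a) t) \<circ> (\<lambda>t. (fst a, t))) differentiable (at (\<theta> w))"
    by (intro differentiable_chain_at f_differentiable[OF w e]) (auto intro!: derivative_intros)
  then have "f w a differentiable (at (\<theta> w))" by (simp add: o_def)
  from directional_derivative_LIMSEQ[OF this]
  show "(\<lambda>k. ?q k a) \<longlonglongrightarrow> param_jac f \<theta> w a $ j $ i"
    by (simp add: param_jac_def transpose_def jacobian_def matrix_def)
qed

lemma input_jac_measurable:
  assumes w: "layer w \<noteq> 0"
  shows "(\<lambda>a. input_jac f \<theta> u w a $ j $ i) \<in> borel_measurable (borel \<Otimes>\<^sub>M \<Xi> w)"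
proof (rule borel_measurable_LIMSEQ_metric)
  \<comment> \<open>Perturbing parent slot \<open>u\<close> is a translation by
    \<open>axis u d\<close>, hence a measurable map of the whole observation.\<close>
  let ?f = "\<lambda>d a. f w (fst a + axis u d, snd a) (\<theta> w) $ i"
  let ?d = "\<lambda>k. inverse (real (Suc k)) *\<^sub>R axis j 1 :: real ^ 'c"
  let ?q = "\<lambda>k a. (?f (?d k) a - ?f 0 a) / inverse (real (Suc k))"
  have f: "(\<lambda>a. f w a (\<theta> w) $ i) \<in> borel_measurable (borel \<Otimes>\<^sub>M \<Xi> w)"
    using f_measurable[OF w, of "\<theta> w"] by (simp add: borel_measurable_vec_iff)
  have [measurable]: "?f d \<in> borel_measurable (borel \<Otimes>\<^sub>M \<Xi> w)" for d
    by (rule measurable_compose[OF _ f]) measurable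
  show "?q k \<in> borel_measurable (borel \<Otimes>\<^sub>M \<Xi> w)" for k by measurable
  fix a :: "((real ^ 'c) ^ 'v) \<times> 'e" assume "a \<in> space (borel \<Otimes>\<^sub>M \<Xi> w)"
  then have e: "snd a \<in> space (\<Xi> w)" by (auto simp: space_pair_measure)
  define y where "y = fst a"
  \<comment> \<open>Overwriting slot \<open>u\<close> is an affine map in the new value
    \<open>b\<close>. This links the translations above to the definition of
    \<open>input_jac\<close> and makes the chain rule applicable.\<close>
  have upd: "(\<chi> w'. if w' = u then b else y $ w') = y + axis u (b - y $ u)" for b
    by (simp add: vec_eq_iff axis_def)
  have q: "?f (?d k) a = f w (\<chi> w'. if w' = u then y $ u + ?d k else y $ w', snd a) (\<theta> w) $ i"
    "?f 0 a = f w (\<chi> w'. if w' = u then y $ u else y $ w', snd a) (\<theta> w) $ i" for k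
    unfolding upd by (simp_all add: y_def)
  have "linear (axis u :: real ^ 'c \<Rightarrow> _)"
    by (intro linearI) (simp_all add: vec_eq_iff axis_def)
  then have "bounded_linear (axis u :: real ^ 'c \<Rightarrow> (real ^ 'c) ^ 'v)"
    by (rule linear_conv_bounded_linear[THEN iffD1])
  then have "(axis u \<circ> (\<lambda>b. b - y $ u)) differentiable (at (y $ u))"
    by (intro differentiable_chain_at[OF _ bounded_linear_imp_differentiable]) (auto intro!: derivative_intros)
  then have "(\<lambda>b. axis u (b - y $ u)) differentiable (at (y $ u))" by (simp add: o_def)
  then have "((\<lambda>(y, t). f w (y, snd a) t) \<circ> (\<lambda>b. (y + axis u (b - y $ u), \<theta> w))) differentiable (at (y $ u))"
    by (intro differentiable_chain_at f_differentiable[OF w e]) (auto intro!: derivative_intros)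
  then have "(\<lambda>b. f w (\<chi> w'. if w' = u then b else y $ w', snd a) (\<theta> w)) differentiable (at (y $ u))"
    by (simp add: o_def upd)
  from directional_derivative_LIMSEQ[OF this, of "axis j 1" i]
  show "(\<lambda>k. ?q k a) \<longlonglongrightarrow> input_jac f \<theta> u w a $ j $ i"
    unfolding q by (simp only: input_jac_def transpose_def jacobian_def matrix_def y_def vec_lambda_beta)
qed

end

section \<open>Error propagation along the graph and the bias of the synthetic parameter
  gradient\<close>

theorem theorem3:
  fixes M :: "'w measure" and N :: "'s measure"
    and E :: "('v::finite \<times> 'v) set" and layer :: "'v \<Rightarrow> nat" and L :: nat
    and C :: "'v \<Rightarrow> 'c::finite set" and P :: "'v \<Rightarrow> 'p::finite set"
    and \<Xi> :: "'v \<Rightarrow> 'e measure" and \<xi> :: "'v \<Rightarrow> 'w \<Rightarrow> 'e"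
    and f :: "'v \<Rightarrow> ((real ^ 'c) ^ 'v) \<times> 'e \<Rightarrow> real ^ 'p \<Rightarrow> real ^ 'c"
    and \<theta> :: "'v \<Rightarrow> real ^ 'p"
    and x :: "'v \<Rightarrow> 'w \<Rightarrow> real ^ 'c"
    and z :: "'v \<Rightarrow> 'w \<Rightarrow> ((real ^ 'c) ^ 'v) \<times> 'e"
    and g g' :: "'v \<Rightarrow> 'w \<Rightarrow> real ^ 'c"
    and he :: "'v \<Rightarrow> 'v \<Rightarrow> 'w \<Rightarrow> real ^ 'c" and h :: "'v \<Rightarrow> 'w \<Rightarrow> real ^ 'c"
    and lam c :: "'v \<Rightarrow> real" and \<epsilon> \<epsilon>' J :: real
    and n :: nat and W :: "nat \<Rightarrow> 's \<Rightarrow> 'w" and v :: 'v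
    and p s g\<theta> :: "'w \<Rightarrow> real ^ 'p"
  assumes model: "layered_model M E layer L C P \<Xi> \<xi> f \<theta> x z"
    \<comment> \<open>backpropagated gradients \<open>g\<close>\<close>
    and g_sq: "\<And>u. square_integrable M (g u)"
    and g_coord: "\<And>u \<omega>. \<omega> \<in> space M \<Longrightarrow> g u \<omega> \<in> coord_space (C u)"
    and g_eq: "\<And>u \<omega>. layer u \<noteq> L \<Longrightarrow> \<omega> \<in> space M \<Longrightarrow>
      g u \<omega> = (\<Sum>w\<in>ch E u. input_jac f \<theta> u w (z w \<omega>) *v g w \<omega>)"
    \<comment> \<open>synthetic gradients \<open>he u w\<close> on edges, and the gradients \<open>g'\<close> they propagate\<close>
    and lam: "\<And>u. 0 \<le> lam u \<and> lam u \<le> 1"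
    and he_sq: "\<And>u w. (u, w) \<in> E \<Longrightarrow> square_integrable M (he u w)"
    and he_coord: "\<And>u w \<omega>. (u, w) \<in> E \<Longrightarrow> \<omega> \<in> space M \<Longrightarrow> he u w \<omega> \<in> coord_space (C u)"
    and g'_sq: "\<And>u. square_integrable M (g' u)"
    and g'_terminal: "\<And>u \<omega>. layer u = L \<Longrightarrow> \<omega> \<in> space M \<Longrightarrow> g' u \<omega> = g u \<omega>"
    and g'_eq: "\<And>u \<omega>. layer u \<noteq> L \<Longrightarrow> \<omega> \<in> space M \<Longrightarrow>
      g' u \<omega> = (\<Sum>w\<in>ch E u. lam u *\<^sub>R (input_jac f \<theta> u w (z w \<omega>) *v g' w \<omega>)
                             + (1 - lam u) *\<^sub>R he u w \<omega>)"
    and pos: "\<epsilon> > 0" "\<epsilon>' > 0" "J > 0"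
    and B': "\<And>u U. layer u \<noteq> 0 \<Longrightarrow> U \<subseteq> an_sib E layer u \<Longrightarrow>
      AE \<omega> in M. norm (vec_cond_exp M (obs_algebra M \<Xi> z {u}) (g u) \<omega>
                       - vec_cond_exp M (obs_algebra M \<Xi> z (insert u U)) (g u) \<omega>) \<le> \<epsilon>"
    and h_sq: "\<And>u w. (u, w) \<in> E \<Longrightarrow> square_integrable M (h w)"
    and h_coord: "\<And>u w \<omega>. (u, w) \<in> E \<Longrightarrow> \<omega> \<in> space M \<Longrightarrow> h w \<omega> \<in> coord_space (C w)"
    and he_form: "\<And>u w. (u, w) \<in> E \<Longrightarrow>
      AE \<omega> in M. he u w \<omega> = input_jac f \<theta> u w (z w \<omega>) *v h w \<omega>"
    and h_approx: "\<And>u w. (u, w) \<in> E \<Longrightarrow>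
      AE \<omega> in M. norm (h w \<omega> - vec_cond_exp M (obs_algebra M \<Xi> z {w}) (g' w) \<omega>) \<le> \<epsilon>'"
    and input_jac_le: "\<And>u w. (u, w) \<in> E \<Longrightarrow>
      AE \<omega> in M. spectral_norm (input_jac f \<theta> u w (z w \<omega>)) \<le> J"
    and param_jac_le: "\<And>u. layer u \<noteq> 0 \<Longrightarrow>
      AE \<omega> in M. spectral_norm (param_jac f \<theta> u (z u \<omega>)) \<le> J"
    and v: "layer v \<noteq> 0" "layer v \<noteq> L"
    and p_def: "p = (\<lambda>\<omega>. param_jac f \<theta> v (z v \<omega>) *v
      (\<Sum>w\<in>ch E v. input_jac f \<theta> v w (z w \<omega>) *v g' w \<omega>))"
    and s_def: "s = (\<lambda>\<omega>. param_jac f \<theta> v (z v \<omega>) *v (\<Sum>w\<in>ch E v. he v w \<omega>))"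
    and g\<theta>_def: "g\<theta> = (\<lambda>\<omega>. param_jac f \<theta> v (z v \<omega>) *v g v \<omega>)"
    and n: "n \<ge> 1"
    and draws: "iid_draws N M n W"
    and c_terminal: "\<And>u. layer u = L \<Longrightarrow> c u = 0"
    and c_eq: "\<And>u. layer u \<noteq> L \<Longrightarrow> c u = J * (\<Sum>w\<in>ch E u. 1 - lam u + c w)"
    and var_gap: "(tr_cov M p - tr_cov M s) / real n
      > (J\<^sup>2 * (\<epsilon> + \<epsilon>') * (\<Sum>w\<in>ch E v. 1 + c w))\<^sup>2"
  shows "optimal_weight M N n W p s (\<integral>\<omega>. g\<theta> \<omega> \<partial>M) < 1"
proof -
  interpret layered_model M E layer L C P \<Xi> \<xi> f \<theta> x z by (rule model)
  let ?O = "obs_algebra M \<Xi> z" and ?e = "\<epsilon> + \<epsilon>'"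
  let ?J = "\<lambda>u w \<omega>. input_jac f \<theta> u w (z w \<omega>)" and ?J\<theta> = "\<lambda>\<omega>. param_jac f \<theta> v (z v \<omega>)"
  have e: "0 \<le> ?e" using pos by simp
  note int = integrable_if_square_integrable
  have g_int: "integrable M (g u)" and g'_int: "integrable M (g' u)" for u
    using int[OF g_sq] int[OF g'_sq] by auto
  have h_int: "integrable M (h w)" if "(u, w) \<in> E" for u w using int[OF h_sq[OF that]] .
  have layer_child: "layer w \<noteq> 0" if "(u, w) \<in> E" for u w
    using edge_layer[OF that] by simp
  have child_layer: "L - layer w < L - layer u" "layer u \<noteq> L" if "(u, w) \<in> E" for u w
    using edge_layer[OF that] layer_le[of w] by auto
  have sub: "subalgebra M (?O S)" if "S \<subseteq> insert u (an_sib E layer u)" "layer u \<noteq> 0" for S u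
    using that layer_an_sib by (intro obs_algebra_subalgebra) auto
  have J_meas: "(\<lambda>\<omega>. ?J u w \<omega> $ i $ j) \<in> borel_measurable (?O S)"
    if "(u, w) \<in> E" "w \<in> S" for u w S i j
    by (rule measurable_compose[OF z_measurable_obs_algebra input_jac_measurable])
      (use that layer_child in auto)
  have J_meas': "(\<lambda>\<omega>. ?J u w \<omega> $ i $ j) \<in> borel_measurable M" if "(u, w) \<in> E" for u w i j
    by (rule measurable_compose[OF z_measurable input_jac_measurable])
      (use that layer_child in auto)
  have J\<theta>_meas: "(\<lambda>\<omega>. ?J\<theta> \<omega> $ i $ j) \<in> borel_measurable (?O {v})" for i j
    by (rule measurable_compose[OF z_measurable_obs_algebra param_jac_measurable]) (use v in auto)
  have J\<theta>_meas': "(\<lambda>\<omega>. ?J\<theta> \<omega> $ i $ j) \<in> borel_measurable M" for i j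
    by (rule measurable_compose[OF z_measurable param_jac_measurable]) (use v in auto)
  have c_nonneg: "0 \<le> c u" for u
  \<comment> \<open>Every child is one layer closer to \<open>L\<close>, so the distance
    \<open>L - layer u\<close> drops strictly along edges.\<close>
  proof (induction "L - layer u" arbitrary: u rule: less_induct)
    case less
    show ?case
    proof (cases "layer u = L")
      case False
      have "0 \<le> 1 - lam u + c w" if "w \<in> ch E u" for w
        using less child_layer(1) lam[of u] that by (simp add: ch_def add_nonneg_nonneg)
      then show ?thesis using c_eq[OF False] pos(3) by (simp add: sum_nonneg)
    qed (simp add: c_terminal)
  qed
  \<comment> \<open>One edge: (B') at \<open>w\<close> admits the extra observations
    \<open>insert u U\<close>, since the extended ancestors of \<open>u\<close> are among those of
    \<open>w\<close>. As \<open>h w\<close> approximates an expectation given \<open>z w\<close>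
    alone, the error of \<open>g' w\<close> is needed only given \<open>z w\<close>.\<close>
  have h_bound: "cond_norm_le M (?O (insert w (insert u U))) (\<lambda>\<omega>. h w \<omega> - g w \<omega>) ((1 + c w) * ?e)"
    if uw: "(u, w) \<in> E" "layer u \<noteq> 0" and U: "U \<subseteq> an_sib E layer u"
      and IH: "cond_norm_le M (?O {w}) (\<lambda>\<omega>. g' w \<omega> - g w \<omega>) (c w * ?e)" for u w U
  proof -
    have anc: "insert u U \<subseteq> an_sib E layer w"
      using an_sib_parent[OF uw(1)] self_in_an_sib[OF uw(2)] U by auto
    have "cond_norm_le M (?O (insert w (insert u U))) (\<lambda>\<omega>. h w \<omega> - g w \<omega>) (\<epsilon> + \<epsilon>' + c w * ?e)"
    proof (rule cond_norm_le_approx)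
      show "subalgebra M (?O (insert w (insert u U)))"
        using anc layer_child[OF uw(1)] by (intro sub[of _ w]) auto
      show "subalgebra (?O (insert w (insert u U))) (?O {w})" by (intro obs_algebra_mono) auto
      show "integrable M (g w)" "integrable M (g' w)" "integrable M (h w)"
        using g_int g'_int h_int[OF uw(1)] by auto
    qed (rule h_approx[OF uw(1)] B'[OF layer_child[OF uw(1)] anc] IH)+
    then show ?thesis by (simp add: algebra_simps)
  qed
  \<comment> \<open>The set \<open>U\<close> must stay arbitrary: the step at \<open>u\<close> calls
    the induction hypothesis at a child both with \<open>insert u U\<close> and with the empty
    set.\<close>
  have bound: "cond_norm_le M (?O (insert u U)) (\<lambda>\<omega>. g' u \<omega> - g u \<omega>) (c u * ?e)"
    if "layer u \<noteq> 0" "U \<subseteq> an_sib E layer u" for u U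
    using that
  proof (induction "L - layer u" arbitrary: u U rule: less_induct)
    case less
    let ?F = "?O (insert u U)"
    have F: "subalgebra M ?F" using less.prems by (intro sub[of _ u]) auto
    show ?case
    proof (cases "layer u = L")
      case True
      have "cond_norm_le M ?F (\<lambda>\<omega>. g' u \<omega> - g u \<omega>) 0"
        using g'_terminal[OF True] g_int g'_int by (intro cond_norm_le_AE_bounded F) auto
      then show ?thesis by (simp add: c_terminal True)
    next
      case False
      \<comment> \<open>Once \<open>he u w\<close> is written as a Jacobian times
        \<open>h w\<close>, splitting \<open>g w\<close> with weights \<open>lam u\<close> and
        \<open>1 - lam u\<close> makes \<open>g' u - g u\<close> a sum of Jacobians applied to
        \<open>D w\<close>.\<close>
      define D where "D w \<omega> = lam u *\<^sub>R (g' w \<omega> - g w \<omega>) + (1 - lam u) *\<^sub>R (h w \<omega> - g w \<omega>)" for w \<omega>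
      have D_int: "integrable M (D w)" if "(u, w) \<in> E" for w
        using g_int g'_int h_int[OF that] unfolding D_def by simp
      have JD_int: "integrable M (\<lambda>\<omega>. ?J u w \<omega> *v D w \<omega>)" if "(u, w) \<in> E" for w
        by (rule integrable_matrix_vector[OF J_meas'[OF that] input_jac_le[OF that] D_int[OF that]])
      have JD: "cond_norm_le M ?F (\<lambda>\<omega>. ?J u w \<omega> *v D w \<omega>) (J * ((1 - lam u + c w) * ?e))"
        if uw: "(u, w) \<in> E" for w
      proof -
        \<comment> \<open>The Jacobian of the edge is a function of \<open>z w\<close>. So
          \<open>z w\<close> joins the conditioning while the Jacobian is split off, and is then
          dropped by coarsening.\<close>
        let ?F' = "?O (insert w (insert u U))"
        have anc: "insert u U \<subseteq> an_sib E layer w"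
          using an_sib_parent[OF uw] self_in_an_sib[OF less.prems(1)] less.prems(2) by auto
        note IH = less.hyps[OF child_layer(1)[OF uw] layer_child[OF uw]]
        have F': "subalgebra M ?F'"
          using anc layer_child[OF uw] by (intro sub[of _ w]) auto
        \<comment> \<open>The propagated part uses the induction hypothesis with
          \<open>insert u U\<close>; the synthetic part uses it with the empty set, through
          \<open>h_bound\<close>. The combined constant is the summand
          \<open>1 - lam u + c w\<close> of the recursion for \<open>c\<close>.\<close>
        have "cond_norm_le M ?F' (D w) (lam u * (c w * ?e) + (1 - lam u) * ((1 + c w) * ?e))"
          unfolding D_def
          using lam[of u] g_int g'_int h_int[OF uw] IH[OF anc] h_bound[OF uw less.prems] IH[of "{}"]
          by (intro cond_norm_le_add cond_norm_le_scaleR F') auto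
        moreover have "lam u * (c w * ?e) + (1 - lam u) * ((1 + c w) * ?e) = (1 - lam u + c w) * ?e"
          by (simp add: algebra_simps)
        moreover have "0 \<le> (1 - lam u + c w) * ?e" using c_nonneg[of w] lam[of u] e by simp
        ultimately have "cond_norm_le M ?F' (\<lambda>\<omega>. ?J u w \<omega> *v D w \<omega>) (J * ((1 - lam u + c w) * ?e))"
          by (intro cond_norm_le_matrix_vector[OF F' _ input_jac_le[OF uw]] J_meas[OF uw]) auto
        then show ?thesis
          by (rule cond_norm_le_subalgebra) (intro obs_algebra_mono subset_insertI)
      qed
      have "cond_norm_le M ?F (\<lambda>\<omega>. \<Sum>w\<in>ch E u. ?J u w \<omega> *v D w \<omega>)
          (\<Sum>w\<in>ch E u. J * ((1 - lam u + c w) * ?e))"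
        using JD JD_int by (intro cond_norm_le_sum F) (auto simp: ch_def)
      moreover have "(\<Sum>w\<in>ch E u. J * ((1 - lam u + c w) * ?e)) = c u * ?e"
        unfolding c_eq[OF False] by (simp only: sum_distrib_left sum_distrib_right mult.assoc)
      ultimately have *: "cond_norm_le M ?F (\<lambda>\<omega>. \<Sum>w\<in>ch E u. ?J u w \<omega> *v D w \<omega>) (c u * ?e)" by simp
      \<comment> \<open>There are finitely many children, so a single null set serves all edges out
        of \<open>u\<close>.\<close>
      have "AE \<omega> in M. \<forall>w\<in>ch E u. he u w \<omega> = ?J u w \<omega> *v h w \<omega>"
        using he_form by (intro AE_finite_allI) (auto simp: ch_def)
      with AE_space have eq: "AE \<omega> in M. (\<Sum>w\<in>ch E u. ?J u w \<omega> *v D w \<omega>) = g' u \<omega> - g u \<omega>"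
      proof eventually_elim
        case (elim \<omega>)
        then show ?case
          unfolding g_eq[OF False elim(1)] g'_eq[OF False elim(1)] sum_subtractf[symmetric]
          by (intro sum.cong refl) (simp add: D_def matrix_vector_right_distrib
              matrix_vector_mult_diff_distrib matrix_vector_mult_scaleR algebra_simps)
      qed
      show ?thesis
      proof (rule cond_norm_le_cong_AE[OF * eq F])
        show "(\<lambda>\<omega>. \<Sum>w\<in>ch E u. ?J u w \<omega> *v D w \<omega>) \<in> borel_measurable M"
          using JD_int by (intro borel_measurable_sum) (auto simp: ch_def)
        show "(\<lambda>\<omega>. g' u \<omega> - g u \<omega>) \<in> borel_measurable M"
          using g_int[of u] g'_int[of u] by (intro borel_measurable_diff) auto
      qed
    qed
  qed

  \<comment> \<open>Bias of the synthetic parameter gradient at \<open>v\<close>\<close>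
  define D where "D w \<omega> = h w \<omega> - g w \<omega>" for w \<omega>
  have sq_sum: "square_integrable M (\<lambda>\<omega>. ?J\<theta> \<omega> *v (\<Sum>w\<in>ch E v. X w \<omega>))"
    if "\<And>w. (v, w) \<in> E \<Longrightarrow> square_integrable M (X w)" for X
    using that by (intro square_integrable_matrix_vector[OF J\<theta>_meas' param_jac_le[OF v(1)]]
        square_integrable_sum) (auto simp: ch_def)
  have sq_J: "square_integrable M (\<lambda>\<omega>. ?J v w \<omega> *v Y \<omega>)"
    if "(v, w) \<in> E" "square_integrable M Y" for w Y
    using that by (intro square_integrable_matrix_vector[OF J_meas' input_jac_le]) auto
  have p_sq: "square_integrable M p"
    unfolding p_def using sq_J g'_sq by (intro sq_sum) auto
  have s_sq: "square_integrable M s"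
    unfolding s_def using he_sq by (intro sq_sum) auto
  have g\<theta>_sq: "square_integrable M g\<theta>"
    unfolding g\<theta>_def
    by (intro square_integrable_matrix_vector[OF J\<theta>_meas' param_jac_le[OF v(1)]] g_sq)
  have F: "subalgebra M (?O {v})" using v by (intro sub[of _ v]) auto
  have D_int: "integrable M (D w)" if "(v, w) \<in> E" for w
    using g_int h_int[OF that] unfolding D_def by simp
  have JD_int: "integrable M (\<lambda>\<omega>. ?J v w \<omega> *v D w \<omega>)" if "(v, w) \<in> E" for w
    by (rule integrable_matrix_vector[OF J_meas'[OF that] input_jac_le[OF that] D_int[OF that]])
  have B_nonneg: "0 \<le> (1 + c w) * ?e" for w using c_nonneg[of w] e by simp
  \<comment> \<open>This is the inductive step with mixing weight 0, since \<open>s\<close> uses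
    synthetic gradients only; hence \<open>1 + c w\<close> in place of
    \<open>1 - lam v + c w\<close>.\<close>
  have JD: "cond_norm_le M (?O {v}) (\<lambda>\<omega>. ?J v w \<omega> *v D w \<omega>) (J * ((1 + c w) * ?e))"
    if vw: "(v, w) \<in> E" for w
  proof -
    have F': "subalgebra M (?O {w, v})"
      using v(1) layer_child[OF vw] by (intro obs_algebra_subalgebra) auto
    have "cond_norm_le M (?O {w, v}) (D w) ((1 + c w) * ?e)"
      unfolding D_def using bound[OF layer_child[OF vw], of "{}"] by (intro h_bound[OF vw v(1)]) auto
    then have "cond_norm_le M (?O {w, v}) (\<lambda>\<omega>. ?J v w \<omega> *v D w \<omega>) (J * ((1 + c w) * ?e))"
      using B_nonneg by (intro cond_norm_le_matrix_vector[OF F' _ input_jac_le[OF vw]] J_meas[OF vw]) auto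
    then show ?thesis by (rule cond_norm_le_subalgebra) (intro obs_algebra_mono subset_insertI)
  qed
  \<comment> \<open>\<open>Y\<close> equals \<open>s - g\<theta>\<close> almost surely, once
    \<open>g v\<close> is expanded by backpropagation; its mean is the bias of
    \<open>s\<close>.\<close>
  define Y where "Y \<omega> = ?J\<theta> \<omega> *v (\<Sum>w\<in>ch E v. ?J v w \<omega> *v D w \<omega>)" for \<omega>
  have sum_int: "integrable M (\<lambda>\<omega>. \<Sum>w\<in>ch E v. ?J v w \<omega> *v D w \<omega>)"
    using JD_int by (intro Bochner_Integration.integrable_sum) (auto simp: ch_def)
  have Y_int: "integrable M Y"
    unfolding Y_def by (rule integrable_matrix_vector[OF J\<theta>_meas' param_jac_le[OF v(1)] sum_int])
  have "cond_norm_le M (?O {v}) (\<lambda>\<omega>. \<Sum>w\<in>ch E v. ?J v w \<omega> *v D w \<omega>) (\<Sum>w\<in>ch E v. J * ((1 + c w) * ?e))"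
    using JD JD_int by (intro cond_norm_le_sum F) (auto simp: ch_def)
  \<comment> \<open>The conditioning on \<open>z v\<close> was kept for this: it lets the parameter
    Jacobian be split off as well, giving the second factor \<open>J\<close>.\<close>
  then have "cond_norm_le M (?O {v}) Y (J * (\<Sum>w\<in>ch E v. J * ((1 + c w) * ?e)))"
    unfolding Y_def using B_nonneg pos(3)
    by (intro cond_norm_le_matrix_vector[OF F J\<theta>_meas param_jac_le[OF v(1)]])
      (auto intro!: sum_nonneg intro: mult_nonneg_nonneg[OF less_imp_le])
  from norm_expectation_le[OF this Y_int]
  have "norm (\<integral>\<omega>. Y \<omega> \<partial>M) \<le> J * (\<Sum>w\<in>ch E v. J * ((1 + c w) * ?e))" .
  also have "\<dots> = J\<^sup>2 * ?e * (\<Sum>w\<in>ch E v. 1 + c w)"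
    by (simp add: sum_distrib_left power2_eq_square mult_ac del: sum.distrib)
  finally have Y_le: "norm (\<integral>\<omega>. Y \<omega> \<partial>M) \<le> J\<^sup>2 * ?e * (\<Sum>w\<in>ch E v. 1 + c w)" .
  have "AE \<omega> in M. \<forall>w\<in>ch E v. he v w \<omega> = ?J v w \<omega> *v h w \<omega>"
    using he_form by (intro AE_finite_allI) (auto simp: ch_def)
  with AE_space have "AE \<omega> in M. s \<omega> - g\<theta> \<omega> = Y \<omega>"
  proof eventually_elim
    case (elim \<omega>)
    then show ?case
      by (simp add: s_def g\<theta>_def Y_def D_def g_eq[OF v(2)] matrix_vector_mult_diff_distrib
          sum_subtractf)
  qed
  then have "(\<integral>\<omega>. s \<omega> - g\<theta> \<omega> \<partial>M) = (\<integral>\<omega>. Y \<omega> \<partial>M)"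
    using int[OF s_sq] int[OF g\<theta>_sq] Y_int by (intro integral_cong_AE) auto
  then have "(\<integral>\<omega>. s \<omega> \<partial>M) - (\<integral>\<omega>. g\<theta> \<omega> \<partial>M) = (\<integral>\<omega>. Y \<omega> \<partial>M)"
    using int[OF s_sq] int[OF g\<theta>_sq] by simp
  then have "(norm ((\<integral>\<omega>. s \<omega> \<partial>M) - (\<integral>\<omega>. g\<theta> \<omega> \<partial>M)))\<^sup>2 \<le> (J\<^sup>2 * ?e * (\<Sum>w\<in>ch E v. 1 + c w))\<^sup>2"
    using Y_le by (simp add: power_mono)
  also note var_gap
  finally show ?thesis
    by (intro optimal_weight_less_1[OF prob_space_axioms draws n p_sq s_sq])
qed

end
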